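(* Let $f:\mathbb{R}^n\to\mathbb{R}$ be twice continuously differentiable, level-bounded, strictly convex and supercoercive, i.e. $\lim_{\|x\|\to\infty}f(x)/\|x\|=+\infty$, and let $x^\star$ be its unique minimizer. Let $\phi:\mathbb{R}^n\to\mathbb{R}\cup\{+\infty\}$ be proper, lower semicontinuous, essentially smooth and strongly convex with constant $\mu_\phi>0$, and suppose moreover that $\phi\ge 0$, $\phi$ is even, and $\phi(0)=0$. For $x_0\in\mathbb{R}^n$ consider the control system $\dot x(t)=u(t)$, $x(0)=x_0$, and define $$V(x):=D_f(x,x^\star),\qquad q(x,u):=\phi^*(\nabla f(x))+\phi(-u),\qquad J_\infty(x_0,u):=\int_0^\infty q(x(t),u(t))\,dt.$$ Then, for every $x_0\in\mathbb{R}^n$: (a) For any stabilizing control $u$ and all $t\ge 0$, $$\int_0^t q(x(s),u(s))\,ds\ \ge\ V(x_0)-V(x(t)).$$ In particular, $J_\infty(x_0,u)\ge V(x_0)$. (b) The closed-loop system $\dot x(t)=-\nabla\phi^*(\nabla f(x(t)))$, $x(0)=x_0$, gives rise to an optimal stabilizing control $u(t)=-\nabla\phi^*(\nabla f(x(t)))$, for which $$J_\infty(x_0,u)=V(x_0)=D_f(x_0,x^\star).$$ (c) $V$ is a global Lyapunov function for the closed-loop system $\dot x(t)=-\nabla\phi^*(\nabla f(x(t)))$.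
   Context: $\|\cdot\|$ and $\langle\cdot,\cdot\rangle$ are the Euclidean norm and inner product on $\mathbb{R}^n$. $\phi^*(y)=\sup_x\{\langle x,y\rangle-\phi(x)\}$ is the convex conjugate; under the assumptions $\phi^*$ is finite and differentiable on $\mathbb{R}^n$ with $1/\mu_\phi$-Lipschitz gradient. $D_f(x,\bar x)=f(x)-f(\bar x)-\langle\nabla f(\bar x),x-\bar x\rangle$ is the Bregman divergence generated by $f$. $f$ is level-bounded if all its sublevel sets $\{f\le\alpha\}$, $\alpha\in\mathbb{R}$, are bounded. $\phi$ is even if $\phi(-x)=\phi(x)$ for all $x$. A proper, lower semicontinuous, convex function $\phi$ is essentially smooth if $\operatorname{int}(\operatorname{dom}\phi)\neq\emptyset$, $\phi$ is differentiable on $\operatorname{int}(\operatorname{dom}\phi)$, and $\|\nabla\phi(x^\nu)\|\to\infty$ whenever $\operatorname{int}(\operatorname{dom}\phi)\ni x^\nu\to x\in\operatorname{bdry}\operatorname{dom}\phi$, where $\operatorname{dom}\phi=\{x\mid\phi(x)<\infty\}$. A stabilizing control (for the initial point $x_0$) is a function $u:[0,\infty)\to\mathbb{R}^n$, measurable and locally integrable, such that the trajectory $x(t)=x_0+\int_0^t u(s)\,ds$ satisfies $\nabla f(x(t))\to 0$, and thus $x(t)\to x^\star$, as $t\to\infty$. Integrals of the nonnegative function $q$ take values in $[0,+\infty]$. An optimal stabilizing control is one minimizing $J_\infty(x_0,\cdot)$ over all stabilizing controls. $V$ is a global Lyapunov function for a system $\dot x=F(x)$ with equilibrium $x^\star$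 if $V$ is continuously differentiable, $V(x^\star)=0$, $V(x)>0$ for $x\ne x^\star$, $V(x)\to\infty$ as $\|x\|\to\infty$, and $\langle\nabla V(x),F(x)\rangle<0$ for all $x\neq x^\star$. *)

theory Defs
  imports "HOL-Analysis.Analysis"
begin

section \<open>Smooth real-valued functions\<close>

definition grad :: "('a::euclidean_space \<Rightarrow> real) \<Rightarrow> 'a \<Rightarrow> 'a" where
  "grad f x = (THE D. GDERIV f x :> D)"

definition C1_function :: "('a::euclidean_space \<Rightarrow> real) \<Rightarrow> bool" where
  "C1_function f \<longleftrightarrow> (\<forall>x. f differentiable (at x)) \<and> continuous_on UNIV (grad f)"

text \<open>The Hessian is the Frechet derivative of the gradient, continuous in operator norm.\<close>

definition C2_function :: "('a::euclidean_space \<Rightarrow> real) \<Rightarrow> bool" where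
  "C2_function f \<longleftrightarrow> (\<forall>x. f differentiable (at x)) \<and>
     (\<exists>H :: 'a \<Rightarrow> 'a \<Rightarrow>\<^sub>L 'a.
        (\<forall>x. (grad f has_derivative blinfun_apply (H x)) (at x)) \<and> continuous_on UNIV H)"

definition level_bounded :: "('a::euclidean_space \<Rightarrow> real) \<Rightarrow> bool" where
  "level_bounded f \<longleftrightarrow> (\<forall>\<alpha>. bounded {x. f x \<le> \<alpha>})"

definition strictly_convex :: "('a::euclidean_space \<Rightarrow> real) \<Rightarrow> bool" where
  "strictly_convex f \<longleftrightarrow>
     (\<forall>x y t. x \<noteq> y \<longrightarrow> 0 < t \<longrightarrow> t < 1 \<longrightarrow>
        f ((1 - t) *\<^sub>R x + t *\<^sub>R y) < (1 - t) * f x + t * f y)"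

definition supercoercive :: "('a::euclidean_space \<Rightarrow> real) \<Rightarrow> bool" where
  "supercoercive f \<longleftrightarrow> filterlim (\<lambda>x. f x / norm x) at_top at_infinity"

definition bregman :: "('a::euclidean_space \<Rightarrow> real) \<Rightarrow> 'a \<Rightarrow> 'a \<Rightarrow> real" where
  "bregman f x y = f x - f y - grad f y \<bullet> (x - y)"

section \<open>Extended-real-valued convex functions\<close>

definition edom :: "('a \<Rightarrow> ereal) \<Rightarrow> 'a set" where
  "edom \<phi> = {x. \<phi> x < \<infinity>}"

definition proper :: "('a \<Rightarrow> ereal) \<Rightarrow> bool" where
  "proper \<phi> \<longleftrightarrow> (\<forall>x. \<phi> x \<noteq> -\<infinity>) \<and> edom \<phi> \<noteq> {}"

definition lower_semicont :: "('a::topological_space \<Rightarrow> ereal) \<Rightarrow> bool" where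
  "lower_semicont \<phi> \<longleftrightarrow> (\<forall>x. \<phi> x \<le> Liminf (at x) \<phi>)"

text \<open>The next two definitions are meant for functions that never take the value
  \<open>-\<infinity>\<close>, so that no sum of infinities of opposite sign occurs.\<close>

definition econvex :: "('a::real_vector \<Rightarrow> ereal) \<Rightarrow> bool" where
  "econvex \<phi> \<longleftrightarrow>
     (\<forall>x y t. 0 < t \<longrightarrow> t < 1 \<longrightarrow>
        \<phi> ((1 - t) *\<^sub>R x + t *\<^sub>R y) \<le> ereal (1 - t) * \<phi> x + ereal t * \<phi> y)"

definition strongly_convex :: "real \<Rightarrow> ('a::real_normed_vector \<Rightarrow> ereal) \<Rightarrow> bool" where
  "strongly_convex \<mu> \<phi> \<longleftrightarrow>
     (\<forall>x y t. 0 < t \<longrightarrow> t < 1 \<longrightarrow>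
        \<phi> ((1 - t) *\<^sub>R x + t *\<^sub>R y)
          \<le> ereal (1 - t) * \<phi> x + ereal t * \<phi> y - ereal (\<mu> / 2 * t * (1 - t) * (norm (x - y))\<^sup>2))"

text \<open>Gradient at a point near which the function is finite.\<close>

definition egrad :: "('a::euclidean_space \<Rightarrow> ereal) \<Rightarrow> 'a \<Rightarrow> 'a" where
  "egrad \<phi> = grad (\<lambda>x. real_of_ereal (\<phi> x))"

definition essentially_smooth :: "('a::euclidean_space \<Rightarrow> ereal) \<Rightarrow> bool" where
  "essentially_smooth \<phi> \<longleftrightarrow>
     proper \<phi> \<and> lower_semicont \<phi> \<and> econvex \<phi> \<and>
     interior (edom \<phi>) \<noteq> {} \<and>
     (\<forall>x \<in> interior (edom \<phi>). (\<lambda>y. real_of_ereal (\<phi> y)) differentiable (at x)) \<and>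
     (\<forall>X x. (\<forall>n. X n \<in> interior (edom \<phi>)) \<longrightarrow> X \<longlonglongrightarrow> x \<longrightarrow> x \<in> frontier (edom \<phi>) \<longrightarrow>
        filterlim (\<lambda>n. norm (egrad \<phi> (X n))) at_top sequentially)"

definition conjugate :: "('a::real_inner \<Rightarrow> ereal) \<Rightarrow> 'a \<Rightarrow> ereal" where
  "conjugate \<phi> y = (SUP x. ereal (x \<bullet> y) - \<phi> x)"

section \<open>The control problem\<close>

text \<open>Controls are functions on all of \<open>real\<close> of which only the values on
  \<open>[0, \<infinity>)\<close> matter.\<close>

definition trajectory :: "'a::euclidean_space \<Rightarrow> (real \<Rightarrow> 'a) \<Rightarrow> real \<Rightarrow> 'a" where
  "trajectory x0 u t = x0 + (LINT s:{0..t}|lebesgue. u s)"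

definition stabilizing_control ::
    "('a::euclidean_space \<Rightarrow> real) \<Rightarrow> 'a \<Rightarrow> (real \<Rightarrow> 'a) \<Rightarrow> bool" where
  "stabilizing_control f x0 u \<longleftrightarrow>
     u \<in> borel_measurable (lebesgue_on {0..}) \<and>
     (\<forall>T\<ge>0. set_integrable lebesgue {0..T} u) \<and>
     ((\<lambda>t. grad f (trajectory x0 u t)) \<longlongrightarrow> 0) at_top"

definition stage_cost ::
    "('a::euclidean_space \<Rightarrow> real) \<Rightarrow> ('a \<Rightarrow> ereal) \<Rightarrow> 'a \<Rightarrow> 'a \<Rightarrow> ereal" where
  "stage_cost f \<phi> x u = conjugate \<phi> (grad f x) + \<phi> (- u)"

text \<open>The function \<open>e2ennreal\<close> truncates negative values to zero; it is faithful here since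
  \<open>\<phi> \<ge> 0\<close> and \<open>\<phi> 0 = 0\<close> make the stage cost nonnegative.\<close>

definition cost_on ::
    "real set \<Rightarrow> ('a::euclidean_space \<Rightarrow> real) \<Rightarrow> ('a \<Rightarrow> ereal) \<Rightarrow> 'a \<Rightarrow> (real \<Rightarrow> 'a) \<Rightarrow> ereal" where
  "cost_on A f \<phi> x0 u =
     enn2ereal (\<integral>\<^sup>+ s \<in> A. e2ennreal (stage_cost f \<phi> (trajectory x0 u s) (u s)) \<partial>lebesgue)"

abbreviation J_infinity ::
    "('a::euclidean_space \<Rightarrow> real) \<Rightarrow> ('a \<Rightarrow> ereal) \<Rightarrow> 'a \<Rightarrow> (real \<Rightarrow> 'a) \<Rightarrow> ereal" where
  "J_infinity \<equiv> cost_on {0..}"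

definition optimal_stabilizing_control ::
    "('a::euclidean_space \<Rightarrow> real) \<Rightarrow> ('a \<Rightarrow> ereal) \<Rightarrow> 'a \<Rightarrow> (real \<Rightarrow> 'a) \<Rightarrow> bool" where
  "optimal_stabilizing_control f \<phi> x0 u \<longleftrightarrow>
     is_arg_min (J_infinity f \<phi> x0) (stabilizing_control f x0) u"

definition closed_loop_field ::
    "('a::euclidean_space \<Rightarrow> real) \<Rightarrow> ('a \<Rightarrow> ereal) \<Rightarrow> 'a \<Rightarrow> 'a" where
  "closed_loop_field f \<phi> x = - egrad (conjugate \<phi>) (grad f x)"

definition solves_ode :: "('a::real_normed_vector \<Rightarrow> 'a) \<Rightarrow> 'a \<Rightarrow> (real \<Rightarrow> 'a) \<Rightarrow> bool" where
  "solves_ode F x0 x \<longleftrightarrow>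
     x 0 = x0 \<and> (\<forall>t\<ge>0. (x has_vector_derivative F (x t)) (at t within {0..}))"

definition global_lyapunov ::
    "('a::euclidean_space \<Rightarrow> real) \<Rightarrow> ('a \<Rightarrow> 'a) \<Rightarrow> 'a \<Rightarrow> bool" where
  "global_lyapunov V F xs \<longleftrightarrow>
     F xs = 0 \<and> C1_function V \<and> V xs = 0 \<and> (\<forall>x. x \<noteq> xs \<longrightarrow> V x > 0) \<and>
     filterlim V at_top at_infinity \<and> (\<forall>x. x \<noteq> xs \<longrightarrow> grad V x \<bullet> F x < 0)"

end

theory Submission
  imports Defs
begin

text \<open>
  By Fenchel--Young, the stage cost \<open>\<phi>\<^sup>*(\<nabla>f(x)) + \<phi>(-u)\<close> dominates
  \<open>-\<langle>\<nabla>f(x), u\<rangle>\<close>, the rate at which \<open>V = f - f(x\<^sup>\<star>)\<close> decreases along a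
  trajectory; equality holds exactly when \<open>-u\<close> attains the supremum defining
  \<open>\<phi>\<^sup>*(\<nabla>f(x))\<close>, that is, for the closed loop. Integrating gives the cost bound, and
  the bound is attained in the limit because \<open>V\<close> tends to \<open>0\<close> along stabilized trajectories.
  Under the closed loop \<open>V\<close> decreases strictly off \<open>x\<^sup>\<star>\<close>: a vanishing velocity
  would make \<open>\<nabla>f(x)\<close> a subgradient of \<open>\<phi>\<close> at \<open>0\<close>, which is an interior
  point of the domain by evenness, so that \<open>\<nabla>f(x) = \<nabla>\<phi>(0) = 0\<close>.
\<close>

section \<open>Gradients\<close>

lemma GDERIV_unique:
  assumes "GDERIV f x :> D" "GDERIV f x :> E" shows "D = E"
proof -
  have "(\<lambda>h. h \<bullet> D) = (\<lambda>h. h \<bullet> E)"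
    using assms unfolding gderiv_def by (rule has_derivative_unique)
  then show ?thesis by (metis vector_eq_ldot)
qed

lemma grad_eqI: "GDERIV f x :> D \<Longrightarrow> grad f x = D"
  unfolding grad_def by (rule the_equality) (auto intro: GDERIV_unique)

lemma GDERIV_grad:
  fixes f :: "'a::euclidean_space \<Rightarrow> real"
  assumes "f differentiable (at x)"
  shows "GDERIV f x :> grad f x"
proof -
  obtain f' where f': "(f has_derivative f') (at x)"
    using assms by (auto simp: differentiable_def)
  \<comment> \<open>The adjoint evaluated at 1 is the Riesz vector representing the functional
    \<open>f'\<close>.\<close>
  have "f' = (\<lambda>h. h \<bullet> adjoint f' 1)"
    by (simp add: adjoint_works[OF has_derivative_linear[OF f']])
  then have "GDERIV f x :> adjoint f' 1"
    unfolding gderiv_def using f' by simp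
  with grad_eqI[OF this] show ?thesis by simp
qed

lemma GDERIV_has_vector_derivative:
  fixes f :: "'a::real_inner \<Rightarrow> real"
  assumes "GDERIV f (x t) :> D" "(x has_vector_derivative v) (at t within S)"
  shows "((\<lambda>t. f (x t)) has_real_derivative v \<bullet> D) (at t within S)"
proof -
  have "((\<lambda>t. f (x t)) has_derivative (\<lambda>h. (h *\<^sub>R v) \<bullet> D)) (at t within S)"
    using has_derivative_compose[OF assms(2)[unfolded has_vector_derivative_def] assms(1)[unfolded gderiv_def]] .
  then show ?thesis
    by (simp add: has_field_derivative_def mult_commute_abs mult.commute[of "v \<bullet> D"])
qed

text \<open>Along the segment from \<open>x\<close> to \<open>y\<close>, convexity bounds every
  difference quotient at 0 by the chord slope \<open>f y - f x\<close>; its limit from the right is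
  the directional derivative.\<close>

lemma strictly_convex_above_tangent:
  fixes f :: "'a::euclidean_space \<Rightarrow> real"
  assumes sc: "strictly_convex f" and diff: "f differentiable (at x)"
  shows "f x + grad f x \<bullet> (y - x) \<le> f y"
proof (cases "x = y")
  case False
  define h where "h t = f (x + t *\<^sub>R (y - x))" for t
  have "GDERIV f (x + 0 *\<^sub>R (y - x)) :> grad f x"
    using GDERIV_grad[OF diff] by simp
  moreover have "((\<lambda>t. x + t *\<^sub>R (y - x)) has_vector_derivative (y - x)) (at_right 0)"
    by (auto intro!: derivative_eq_intros simp: has_vector_derivative_def)
  ultimately have "(h has_real_derivative (y - x) \<bullet> grad f x) (at_right 0)"
    unfolding h_def by (rule GDERIV_has_vector_derivative)
  then have "((\<lambda>t. (h t - h 0) / (t - 0)) \<longlongrightarrow> (y - x) \<bullet> grad f x) (at_right 0)"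
    by (simp add: has_field_derivative_iff)
  moreover have "eventually (\<lambda>t. (h t - h 0) / (t - 0) \<le> f y - f x) (at_right (0::real))"
    unfolding eventually_at_right_field
  proof (intro exI[of _ 1] conjI allI impI)
    fix t :: real assume t: "0 < t" "t < 1"
    have "h t = f ((1 - t) *\<^sub>R x + t *\<^sub>R y)"
      by (simp add: h_def algebra_simps)
    also have "\<dots> < (1 - t) * f x + t * f y"
      using sc False t unfolding strictly_convex_def by blast
    finally show "(h t - h 0) / (t - 0) \<le> f y - f x"
      using t by (simp add: h_def field_simps)
  qed auto
  ultimately have "(y - x) \<bullet> grad f x \<le> f y - f x"
    by (intro tendsto_upperbound) auto
  then show ?thesis by (simp add: inner_commute)
qed simp

section \<open>Conjugates of strongly convex functions\<close>

locale strongly_convex_penalty =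
  fixes \<phi> :: "'a::euclidean_space \<Rightarrow> ereal" and \<mu> :: real
  assumes lsc: "lower_semicont \<phi>"
    and mu_pos: "0 < \<mu>"
    and strong: "strongly_convex \<mu> \<phi>"
    and nonneg: "0 \<le> \<phi> x"
    and zero: "\<phi> 0 = 0"
begin

section \<open>Quadratic growth of the penalty\<close>

text \<open>Outside \<open>edom \<phi>\<close> the value is 0, the default of
  \<open>real_of_ereal\<close> at infinity, so membership in \<open>edom \<phi>\<close> accompanies
  the convexity and growth estimates.\<close>

definition rphi :: "'a \<Rightarrow> real" where "rphi x = real_of_ereal (\<phi> x)"

lemma phi_eq: "x \<in> edom \<phi> \<Longrightarrow> \<phi> x = ereal (rphi x)"
  using nonneg[of x] by (cases "\<phi> x") (auto simp: edom_def rphi_def)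

lemma phi_eq_top: "x \<notin> edom \<phi> \<Longrightarrow> \<phi> x = \<infinity>"
  by (auto simp: edom_def)

lemma zero_in_edom: "0 \<in> edom \<phi>" and rphi_zero: "rphi 0 = 0"
  by (simp_all add: edom_def rphi_def zero)

lemma rphi_strongly_convex:
  assumes "x \<in> edom \<phi>" "y \<in> edom \<phi>" "0 < t" "t < 1"
  shows "(1 - t) *\<^sub>R x + t *\<^sub>R y \<in> edom \<phi>"
    and "rphi ((1 - t) *\<^sub>R x + t *\<^sub>R y)
      \<le> (1 - t) * rphi x + t * rphi y - \<mu> / 2 * t * (1 - t) * (norm (x - y))\<^sup>2"
proof -
  let ?z = "(1 - t) *\<^sub>R x + t *\<^sub>R y"
  have "\<phi> ?z \<le> ereal (1 - t) * \<phi> x + ereal t * \<phi> y - ereal (\<mu> / 2 * t * (1 - t) * (norm (x - y))\<^sup>2)"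
    using strong assms unfolding strongly_convex_def by blast
  then have le: "\<phi> ?z \<le> ereal ((1 - t) * rphi x + t * rphi y - \<mu> / 2 * t * (1 - t) * (norm (x - y))\<^sup>2)"
    by (simp add: phi_eq assms)
  then show z: "?z \<in> edom \<phi>"
    by (auto simp: edom_def intro: le_less_trans)
  show "rphi ?z \<le> (1 - t) * rphi x + t * rphi y - \<mu> / 2 * t * (1 - t) * (norm (x - y))\<^sup>2"
    using le by (simp add: phi_eq[OF z])
qed

lemma rphi_nonneg: "0 \<le> rphi x"
  unfolding rphi_def using nonneg by (rule real_of_ereal_pos)

lemma convex_edom: "convex (edom \<phi>)"
proof (rule convexI)
  fix x y and u v :: real
  assume *: "x \<in> edom \<phi>" "y \<in> edom \<phi>" "0 \<le> u" "0 \<le> v" "u + v = 1"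
  show "u *\<^sub>R x + v *\<^sub>R y \<in> edom \<phi>"
  proof (cases "v = 0 \<or> v = 1")
    case True then show ?thesis using * by auto
  next
    case False
    then have "0 < v" "v < 1" "u = 1 - v" using * by (cases "u = 0"; auto)+
    then show ?thesis using rphi_strongly_convex(1)[OF *(1,2)] by simp
  qed
qed

text \<open>Maximality of \<open>p\<close> is tested against points of the segment from
  \<open>p\<close> to \<open>x\<close>. Dividing the strong convexity inequality by the weight t of
  \<open>x\<close> leaves the quadratic gap with factor s = 1 - t, and s is then taken up to
  1.\<close>

lemma rphi_quadratic_growth:
  assumes "x \<in> edom \<phi>" "p \<in> edom \<phi>"
    and max: "\<And>z. z \<in> edom \<phi> \<Longrightarrow> z \<bullet> y - rphi z \<le> p \<bullet> y - rphi p"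
  shows "x \<bullet> y - rphi x + \<mu> / 2 * (norm (x - p))\<^sup>2 \<le> p \<bullet> y - rphi p"
proof -
  have "s * (\<mu> / 2 * (norm (x - p))\<^sup>2) \<le> (p \<bullet> y - rphi p) - (x \<bullet> y - rphi x)"
    if "0 < s" "s < 1" for s
  proof -
    define t where "t = 1 - s"
    have t: "0 < t" "t < 1" "s = 1 - t" using that by (auto simp: t_def)
    let ?z = "(1 - t) *\<^sub>R p + t *\<^sub>R x"
    have "?z \<bullet> y - rphi ?z \<le> p \<bullet> y - rphi p"
      using rphi_strongly_convex(1)[OF assms(2,1) t(1,2)] max by blast
    moreover have "?z \<bullet> y = (1 - t) * (p \<bullet> y) + t * (x \<bullet> y)"
      by (simp add: inner_left_distrib)
    moreover have "\<mu> / 2 * t * (1 - t) * (norm (p - x))\<^sup>2 = t * (s * (\<mu> / 2 * (norm (x - p))\<^sup>2))"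
      by (simp add: t(3) norm_minus_commute)
    ultimately have "t * (s * (\<mu> / 2 * (norm (x - p))\<^sup>2)) \<le> t * ((p \<bullet> y - rphi p) - (x \<bullet> y - rphi x))"
      using rphi_strongly_convex(2)[OF assms(2,1) t(1,2)]
      by (simp add: left_diff_distrib right_diff_distrib)
    then show ?thesis using t(1) by simp
  qed
  then have "\<mu> / 2 * (norm (x - p))\<^sup>2 \<le> (p \<bullet> y - rphi p) - (x \<bullet> y - rphi x)"
    by (rule field_le_mult_one_interval)
  then show ?thesis by simp
qed

text \<open>For the zero linear functional the maximizer is 0, since \<phi> is nonnegative and
  vanishes there.\<close>

lemma rphi_quadratic_lower_bound:
  assumes "x \<in> edom \<phi>" shows "\<mu> / 2 * (norm x)\<^sup>2 \<le> rphi x"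
  using rphi_quadratic_growth[OF assms zero_in_edom, of 0] rphi_nonneg by (simp add: rphi_zero)

section \<open>Attainment of the supremum in the conjugate\<close>

text \<open>A real \<open>r\<close> strictly between the affine value and \<open>\<phi> x0\<close>
  separates the two sides near \<open>x0\<close>, so the complement is open. \<open>Liminf\<close>
  sees only punctured neighbourhoods; the point \<open>x0\<close> itself is added by hand.\<close>

lemma closed_sublevel_affine: "closed {x. \<phi> x \<le> ereal (x \<bullet> y - a)}"
proof -
  have "open {x. ereal (x \<bullet> y - a) < \<phi> x}"
  proof (subst open_subopen, intro ballI)
    fix x0 assume "x0 \<in> {x. ereal (x \<bullet> y - a) < \<phi> x}"
    then have "ereal (x0 \<bullet> y - a) < \<phi> x0" by simp
    from ereal_dense2[OF this] obtain r where r: "ereal (x0 \<bullet> y - a) < ereal r" "ereal r < \<phi> x0"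
      by auto
    have "eventually (\<lambda>x. ereal r < \<phi> x) (at x0)"
      using lsc[unfolded lower_semicont_def, rule_format, of x0] r(2)
      unfolding le_Liminf_iff by blast
    then have 1: "eventually (\<lambda>x. ereal r < \<phi> x) (nhds x0)"
      using r(2) unfolding eventually_nhds_conv_at by blast
    have "((\<lambda>x. x \<bullet> y - a) \<longlongrightarrow> x0 \<bullet> y - a) (nhds x0)"
      by (intro tendsto_intros filterlim_ident)
    then have 2: "eventually (\<lambda>x. x \<bullet> y - a < r) (nhds x0)"
      using r(1) by (intro order_tendstoD) auto
    have "eventually (\<lambda>x. ereal (x \<bullet> y - a) < \<phi> x) (nhds x0)"
      using 1 2 by eventually_elim (metis less_ereal.simps(1) less_trans)
    then show "\<exists>T. open T \<and> x0 \<in> T \<and> T \<subseteq> {x. ereal (x \<bullet> y - a) < \<phi> x}"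
      unfolding eventually_nhds by blast
  qed
  moreover have "- {x. \<phi> x \<le> ereal (x \<bullet> y - a)} = {x. ereal (x \<bullet> y - a) < \<phi> x}"
    by auto
  ultimately show ?thesis by (simp add: closed_def)
qed

text \<open>The quadratic lower bound dominates the linear term, so the supremum is finite. The
  points within 1/(n+1) of it form a decreasing sequence of nonempty compact sets, and any common
  point is a maximizer.\<close>

lemma maximizer_exists:
  "\<exists>p\<in>edom \<phi>. \<forall>x\<in>edom \<phi>. x \<bullet> y - rphi x \<le> p \<bullet> y - rphi p"
proof -
  define S where "S = (\<lambda>x. x \<bullet> y - rphi x) ` edom \<phi>"
  define m where "m = Sup S"
  have bdd: "bdd_above S"
  proof (rule bdd_aboveI)
    fix s assume "s \<in> S"
    then obtain x where x: "x \<in> edom \<phi>" "s = x \<bullet> y - rphi x" by (auto simp: S_def)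
    \<comment> \<open>This square yields Young's inequality in the weighted form that cancels the
      quadratic lower bound of \<open>rphi\<close>.\<close>
    have "0 \<le> (\<mu> * norm x - norm y)\<^sup>2" by simp
    then have "\<mu> * (norm x * norm y) \<le> \<mu> * (\<mu> / 2 * (norm x)\<^sup>2 + (norm y)\<^sup>2 / (2 * \<mu>))"
      unfolding power2_diff power_mult_distrib using mu_pos
      by (simp add: distrib_left) (simp add: power2_eq_square)
    then have "norm x * norm y \<le> \<mu> / 2 * (norm x)\<^sup>2 + (norm y)\<^sup>2 / (2 * \<mu>)"
      using mu_pos by (simp only: mult_le_cancel_left_pos)
    then show "s \<le> (norm y)\<^sup>2 / (2 * \<mu>)"
      using x rphi_quadratic_lower_bound[OF x(1)] norm_cauchy_schwarz[of x y] by linarith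
  qed
  have m: "x \<bullet> y - rphi x \<le> m" if "x \<in> edom \<phi>" for x
    unfolding m_def using that by (intro cSup_upper bdd) (auto simp: S_def)
  have m0: "0 \<le> m" using m[OF zero_in_edom] by (simp add: rphi_zero)
  define K where "K n = {x. \<phi> x \<le> ereal (x \<bullet> y - (m - inverse (real (Suc n))))}" for n
  have K_edom: "x \<in> edom \<phi> \<and> rphi x \<le> x \<bullet> y - (m - inverse (real (Suc n)))" if "x \<in> K n" for x n
  proof -
    have le: "\<phi> x \<le> ereal (x \<bullet> y - (m - inverse (real (Suc n))))"
      using that by (simp add: K_def)
    then have "x \<in> edom \<phi>" by (auto simp: edom_def intro: le_less_trans)
    then show ?thesis using le by (simp add: phi_eq)
  qed
  have "\<Inter>(range K) \<noteq> {}"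
  proof (rule compact_nest)
    fix n
    \<comment> \<open>When \<open>norm x\<close> exceeds 1, the additive slack 1 is at most
      \<open>norm x\<close>, so a factor \<open>norm x\<close> cancels from the quadratic estimate.
      The final \<open>+ 1\<close> covers the remaining points of the unit ball.\<close>
    have "norm x \<le> 2 / \<mu> * (norm y + 1) + 1" if "x \<in> K n" for x
    proof (cases "norm x \<le> 1")
      case True
      have "0 \<le> 2 / \<mu> * (norm y + 1)" using mu_pos by simp
      with True show ?thesis by linarith
    next
      case False
      have "inverse (real (Suc n)) \<le> 1"
        by (simp add: inverse_eq_divide)
      then have "\<mu> / 2 * (norm x)\<^sup>2 \<le> x \<bullet> y + 1"
        using K_edom[OF that] rphi_quadratic_lower_bound[of x] m0 by linarith
      also have "\<dots> \<le> norm x * norm y + norm x * 1"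
        using norm_cauchy_schwarz[of x y] False by simp
      finally have "norm x * (\<mu> / 2 * norm x) \<le> norm x * (norm y + 1)"
        by (simp add: power2_eq_square algebra_simps)
      moreover have "0 < norm x" using False by linarith
      ultimately have "\<mu> / 2 * norm x \<le> norm y + 1"
        by (simp only: mult_le_cancel_left_pos)
      then show ?thesis using mu_pos by (simp add: field_simps)
    qed
    then have "bounded (K n)" by (auto simp: bounded_iff)
    then show "compact (K n)"
      unfolding compact_eq_bounded_closed K_def using closed_sublevel_affine by blast
    have "m - inverse (real (Suc n)) < Sup S" by (simp add: m_def)
    then obtain x where "x \<in> edom \<phi>" "m - inverse (real (Suc n)) < x \<bullet> y - rphi x"
      using less_cSupD[of S] zero_in_edom by (auto simp: S_def)
    then have "x \<in> K n" by (simp add: K_def phi_eq)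
    then show "K n \<noteq> {}" by blast
  next
    fix k n :: nat assume "k \<le> n"
    then have "inverse (real (Suc n)) \<le> inverse (real (Suc k))"
      by (intro le_imp_inverse_le) auto
    then show "K n \<subseteq> K k"
      unfolding K_def by (auto elim!: order_trans)
  qed
  then obtain p where p: "\<And>n. p \<in> K n" by auto
  have pm: "m \<le> p \<bullet> y - rphi p"
  proof (rule field_le_epsilon)
    fix e :: real assume "0 < e"
    then obtain n where "inverse (real (Suc n)) < e" using reals_Archimedean by blast
    then show "m \<le> p \<bullet> y - rphi p + e" using K_edom[OF p, of n] by linarith
  qed
  show ?thesis
    using K_edom[OF p] m pm by (intro bexI[of _ p]) force+
qed

section \<open>The conjugate and its gradient\<close>

text \<open>This is the gradient map of the conjugate, as \<open>egrad_conjugate\<close> shows. The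
  choice by \<open>SOME\<close> is unambiguous, since \<open>argmax_growth\<close> leaves room for
  one maximizer only.\<close>

definition argmax :: "'a \<Rightarrow> 'a" where
  "argmax y = (SOME p. p \<in> edom \<phi> \<and> (\<forall>x\<in>edom \<phi>. x \<bullet> y - rphi x \<le> p \<bullet> y - rphi p))"

lemma argmax_in_edom: "argmax y \<in> edom \<phi>"
  and argmax_max: "x \<in> edom \<phi> \<Longrightarrow> x \<bullet> y - rphi x \<le> argmax y \<bullet> y - rphi (argmax y)"
  using someI_ex[of "\<lambda>p. p \<in> edom \<phi> \<and> (\<forall>x\<in>edom \<phi>. x \<bullet> y - rphi x \<le> p \<bullet> y - rphi p)"]
    maximizer_exists[of y] unfolding argmax_def by blast+

lemma argmax_growth:
  "x \<in> edom \<phi> \<Longrightarrow>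
     x \<bullet> y - rphi x + \<mu> / 2 * (norm (x - argmax y))\<^sup>2 \<le> argmax y \<bullet> y - rphi (argmax y)"
  by (intro rphi_quadratic_growth argmax_in_edom argmax_max)

definition rconj :: "'a \<Rightarrow> real" where "rconj y = argmax y \<bullet> y - rphi (argmax y)"

lemma conjugate_eq: "conjugate \<phi> y = ereal (rconj y)"
  unfolding conjugate_def
proof (rule antisym)
  show "(SUP x. ereal (x \<bullet> y) - \<phi> x) \<le> ereal (rconj y)"
  proof (rule SUP_least)
    fix x show "ereal (x \<bullet> y) - \<phi> x \<le> ereal (rconj y)"
    proof (cases "x \<in> edom \<phi>")
      case True then show ?thesis using argmax_max[of x y] by (simp add: phi_eq rconj_def)
    qed (simp add: phi_eq_top)
  qed
  have "ereal (rconj y) = ereal (argmax y \<bullet> y) - \<phi> (argmax y)"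
    by (simp add: phi_eq[OF argmax_in_edom] rconj_def)
  also have "\<dots> \<le> (SUP x. ereal (x \<bullet> y) - \<phi> x)"
    by (rule SUP_upper) simp
  finally show "ereal (rconj y) \<le> (SUP x. ereal (x \<bullet> y) - \<phi> x)" .
qed

lemma rconj_nonneg: "0 \<le> rconj y"
  using argmax_max[OF zero_in_edom, of y] by (simp add: rconj_def rphi_zero)

lemma fenchel_young: "ereal (x \<bullet> y) \<le> conjugate \<phi> y + \<phi> x"
proof (cases "x \<in> edom \<phi>")
  case True then show ?thesis using argmax_max[of x y] by (simp add: phi_eq conjugate_eq rconj_def)
qed (simp add: phi_eq_top conjugate_eq)

lemma fenchel_young_argmax: "conjugate \<phi> y + \<phi> (argmax y) = ereal (argmax y \<bullet> y)"
  by (simp add: conjugate_eq phi_eq[OF argmax_in_edom] rconj_def)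

text \<open>Testing the growth inequality with the point 0 traps the maximizer. This is what makes
  \<open>xs\<close> an equilibrium of the closed loop.\<close>

lemma argmax_zero: "argmax 0 = 0"
proof -
  have "\<mu> / 2 * (norm (argmax 0))\<^sup>2 \<le> 0"
    using argmax_growth[OF zero_in_edom, of 0] rphi_nonneg[of "argmax 0"] by (simp add: rphi_zero)
  then show ?thesis using mu_pos by (simp add: mult_le_0_iff)
qed

text \<open>Each maximizer is inserted into the growth inequality of the other; in the sum the
  values of \<open>rphi\<close> cancel.\<close>

lemma argmax_monotone: "\<mu> * (norm (argmax y' - argmax y))\<^sup>2 \<le> (argmax y' - argmax y) \<bullet> (y' - y)"
  using argmax_growth[OF argmax_in_edom, of y y'] argmax_growth[OF argmax_in_edom, of y' y]
  by (simp add: inner_diff_left inner_diff_right norm_minus_commute)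

lemma argmax_lipschitz: "norm (argmax y' - argmax y) \<le> norm (y' - y) / \<mu>"
proof (cases "argmax y' = argmax y")
  case False
  let ?d = "norm (argmax y' - argmax y)"
  have "?d * (\<mu> * ?d) \<le> ?d * norm (y' - y)"
    using argmax_monotone[of y' y] norm_cauchy_schwarz[of "argmax y' - argmax y" "y' - y"]
    by (simp add: power2_eq_square mult.left_commute)
  then have "\<mu> * ?d \<le> norm (y' - y)" using False by simp
  then show ?thesis using mu_pos by (simp add: field_simps)
qed (use mu_pos in simp)

text \<open>Using each maximizer as a competitor for the other places the linearization error
  between 0 and the pairing of the two increments, which the Lipschitz bound makes quadratic in
  \<open>norm (y' - y)\<close>.\<close>

lemma GDERIV_rconj: "GDERIV rconj y :> argmax y"
  unfolding gderiv_def
proof (rule has_derivativeI_sandwich[where e=1 and H="\<lambda>y'. norm (y' - y) / \<mu>"])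
  show "bounded_linear (\<lambda>h. h \<bullet> argmax y)" by (rule bounded_linear_inner_left)
  show "((\<lambda>y'. norm (y' - y) / \<mu>) \<longlongrightarrow> 0) (at y)"
    by (intro tendsto_eq_intros) (use mu_pos in auto)
  fix y' assume "y' \<noteq> y"
  have lo: "0 \<le> rconj y' - rconj y - (y' - y) \<bullet> argmax y"
    using argmax_max[OF argmax_in_edom, of y y']
    by (simp add: rconj_def inner_diff_left inner_diff_right inner_commute)
  have "rconj y' - rconj y - (y' - y) \<bullet> argmax y \<le> (argmax y' - argmax y) \<bullet> (y' - y)"
    using argmax_max[OF argmax_in_edom, of y' y]
    by (simp add: rconj_def inner_diff_left inner_diff_right inner_commute)
  also have "\<dots> \<le> norm (argmax y' - argmax y) * norm (y' - y)"
    by (rule norm_cauchy_schwarz)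
  also have "\<dots> \<le> norm (y' - y) / \<mu> * norm (y' - y)"
    by (intro mult_right_mono argmax_lipschitz) simp
  finally show "norm (rconj y' - rconj y - (y' - y) \<bullet> argmax y) / norm (y' - y) \<le> norm (y' - y) / \<mu>"
    using lo \<open>y' \<noteq> y\<close> by (simp add: field_simps)
qed simp

lemma egrad_conjugate: "egrad (conjugate \<phi>) = argmax"
  unfolding egrad_def conjugate_eq using grad_eqI[OF GDERIV_rconj] by auto

lemma inner_argmax_nonneg: "0 \<le> argmax y \<bullet> y"
  using rconj_nonneg[of y] rphi_nonneg[of "argmax y"] by (simp add: rconj_def)

lemma inner_argmax_pos:
  assumes smooth: "essentially_smooth \<phi>" and even: "\<And>x. \<phi> (- x) = \<phi> x" and "y \<noteq> 0"
  shows "0 < argmax y \<bullet> y"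
proof (rule ccontr)
  assume "\<not> 0 < argmax y \<bullet> y"
  \<comment> \<open>The pairing equals \<open>rconj y + rphi (argmax y)\<close>, a sum of
    nonnegative terms, so both vanish.\<close>
  then have "rphi (argmax y) = 0"
    using rconj_nonneg[of y] rphi_nonneg[of "argmax y"] by (simp add: rconj_def)
  then have "argmax y = 0"
    using rphi_quadratic_lower_bound[OF argmax_in_edom, of y] mu_pos by (simp add: mult_le_0_iff)
  then have le: "x \<bullet> y \<le> rphi x" if "x \<in> edom \<phi>" for x
    using argmax_max[OF that, of y] by (simp add: rphi_zero)
  \<comment> \<open>Evenness puts \<open>- a\<close> into the domain. The midpoint of
    \<open>a\<close> and \<open>- a\<close> is 0, and convexity of the domain makes it interior
    because \<open>a\<close> is.\<close>
  obtain a where a: "a \<in> interior (edom \<phi>)"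
    using smooth by (auto simp: essentially_smooth_def)
  then have "- a \<in> edom \<phi>"
    using interior_subset by (force simp: edom_def even)
  then have "- a - (1 / 2) *\<^sub>R (- a - a) \<in> interior (edom \<phi>)"
    using mem_interior_convex_shrink[OF convex_edom a, of "- a" "1/2"] by simp
  moreover have "- a - (1 / 2) *\<^sub>R (- a - a) = 0"
    by (simp add: algebra_simps flip: scaleR_left_distrib)
  ultimately have int: "0 \<in> interior (edom \<phi>)" by simp
  then have "rphi differentiable (at 0)"
    using smooth by (auto simp: essentially_smooth_def rphi_def[abs_def])
  then have "(rphi has_derivative (\<lambda>h. h \<bullet> grad rphi 0)) (at 0)"
    using GDERIV_grad by (auto simp: gderiv_def)
  then have zeroD: "D = grad rphi 0" if "\<And>x. x \<in> edom \<phi> \<Longrightarrow> x \<bullet> D \<le> rphi x" for D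
  proof -
    have "((\<lambda>x. rphi x - x \<bullet> D) has_derivative (\<lambda>h. h \<bullet> (grad rphi 0 - D))) (at 0)"
      unfolding inner_diff_right
      using \<open>(rphi has_derivative _) _\<close> by (intro derivative_intros)
    moreover have "\<forall>x\<in>interior (edom \<phi>). rphi 0 - 0 \<bullet> D \<le> rphi x - x \<bullet> D"
      using that interior_subset by (force simp: rphi_zero)
    ultimately have "(\<lambda>h. h \<bullet> (grad rphi 0 - D)) = (\<lambda>v. 0)"
      using differential_zero_maxmin[OF int open_interior] by blast
    then have "(grad rphi 0 - D) \<bullet> (grad rphi 0 - D) = 0" by metis
    then show ?thesis by simp
  qed
  \<comment> \<open>Both \<open>y\<close> and 0 are subgradients of \<open>rphi\<close> at 0, so
    both equal its gradient there.\<close>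
  have "y = 0" using zeroD[of y] zeroD[of 0] le rphi_nonneg by simp
  with \<open>y \<noteq> 0\<close> show False ..
qed

end

section \<open>The chain rule along integral curves\<close>

text \<open>The mean value inequality is applied to \<open>f\<close> minus the linear function given
  by \<open>c\<close>, whose gradient on \<open>S\<close> has norm at most \<open>e\<close>.\<close>

lemma C1_increment_bound:
  fixes f :: "'a::euclidean_space \<Rightarrow> real"
  assumes diff: "\<And>z. f differentiable (at z)" and "convex S"
    and close: "\<And>z. z \<in> S \<Longrightarrow> norm (grad f z - c) \<le> e"
    and "y \<in> S" "z \<in> S"
  shows "\<bar>f y - f z - (y - z) \<bullet> c\<bar> \<le> e * norm (y - z)"
proof -
  have "norm ((f y - y \<bullet> c) - (f z - z \<bullet> c)) \<le> e * norm (y - z)"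
  proof (rule differentiable_bound[OF \<open>convex S\<close> _ _ \<open>y \<in> S\<close> \<open>z \<in> S\<close>, where f'="\<lambda>z h. h \<bullet> (grad f z - c)"])
    fix z
    have "(f has_derivative (\<lambda>h. h \<bullet> grad f z)) (at z)"
      using GDERIV_grad[OF diff] by (simp add: gderiv_def)
    then show "((\<lambda>z. f z - z \<bullet> c) has_derivative (\<lambda>h. h \<bullet> (grad f z - c))) (at z within S)"
      unfolding inner_diff_right
      by (intro derivative_intros) (rule has_derivative_at_withinI)
    assume "z \<in> S"
    have "norm (h \<bullet> (grad f z - c)) \<le> e * norm h" for h
      using Cauchy_Schwarz_ineq2[of h "grad f z - c"] mult_left_mono[OF close[OF \<open>z \<in> S\<close>] norm_ge_zero[of h]]
      by (simp add: mult.commute)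
    then show "onorm (\<lambda>h. h \<bullet> (grad f z - c)) \<le> e" by (rule onorm_le)
  qed
  then show ?thesis by (simp add: inner_diff_left algebra_simps)
qed

lemma chain_rule_primitive:
  fixes f :: "'a::euclidean_space \<Rightarrow> real" and u :: "real \<Rightarrow> 'a"
  assumes diff: "\<And>z. f differentiable (at z)" and cont: "continuous_on UNIV (grad f)"
    and u: "u absolutely_integrable_on {0..T}" and "0 \<le> T"
    and x: "\<And>t. t \<in> {0..T} \<Longrightarrow> x t = x0 + integral {0..t} u"
  shows "(\<lambda>s. u s \<bullet> grad f (x s)) absolutely_integrable_on {0..T}"
    and "integral {0..T} (\<lambda>s. u s \<bullet> grad f (x s)) = f (x T) - f (x 0)"
proof -
  let ?w = "\<lambda>s. u s \<bullet> grad f (x s)"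
  have ui: "u integrable_on {0..T}" and nui: "(\<lambda>s. norm (u s)) integrable_on {0..T}"
    using u by (auto simp: absolutely_integrable_on_def)
  have contx: "continuous_on {0..T} x"
    using continuous_on_add[OF continuous_on_const indefinite_integral_continuous_1[OF ui]]
    by (rule continuous_on_cong[THEN iffD2, rotated 2]) (auto simp: x)
  have contg: "continuous_on {0..T} (\<lambda>s. grad f (x s))"
    by (rule continuous_on_compose2[OF cont contx]) auto
  show wa: "?w absolutely_integrable_on {0..T}"
  proof (rule absolutely_integrable_bounded_measurable_product[where h="\<lambda>a b. b \<bullet> a", OF _ _ _ _ u])
    show "bilinear (\<lambda>a b::'a. b \<bullet> a)"
      by (simp add: bilinear_def linear_iff inner_add_left inner_add_right)
    show "(\<lambda>s. grad f (x s)) \<in> borel_measurable (lebesgue_on {0..T})"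
      using contg by (rule continuous_imp_measurable_on_sets_lebesgue) simp
    show "bounded ((\<lambda>s. grad f (x s)) ` {0..T})"
      using compact_continuous_image[OF contg] compact_imp_bounded by blast
  qed simp
  then have wi: "?w integrable_on {0..T}" by (rule absolutely_integrable_on_def[THEN iffD1, THEN conjunct1])
  define W where "W a b = integral {a..b} (\<lambda>s. norm (u s))" for a b
  define E where "E a b = \<bar>f (x b) - f (x a) - integral {a..b} ?w\<bar>" for a b
  \<comment> \<open>\<open>u\<close> is only integrable, so \<open>x\<close> need not be differentiable; instead the error \<open>E\<close> is
    bounded locally by a small multiple of \<open>W\<close>, and both are compatible with concatenating
    intervals.\<close>
  have "E 0 T \<le> e" if "0 < e" for e
  proof -
    have W0: "0 \<le> W 0 T" unfolding W_def by (intro integral_nonneg nui) simp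
    \<comment> \<open>The \<open>+ 1\<close> avoids division by zero for a control with
      \<open>W 0 T = 0\<close>, while still giving
      \<open>\<epsilon> * W 0 T \<le> e\<close>.\<close>
    define \<epsilon> where "\<epsilon> = e / (W 0 T + 1)"
    have \<epsilon>: "0 < \<epsilon>" using W0 that by (simp add: \<epsilon>_def)
    have "(0::real) \<le> 0 \<and> T \<le> T \<longrightarrow> E 0 T \<le> \<epsilon> * W 0 T"
    proof (rule Bolzano[OF \<open>0 \<le> T\<close>, where P="\<lambda>a b. 0 \<le> a \<and> b \<le> T \<longrightarrow> E a b \<le> \<epsilon> * W a b"])
      fix a b c :: real
      assume *: "0 \<le> a \<and> b \<le> T \<longrightarrow> E a b \<le> \<epsilon> * W a b" "0 \<le> b \<and> c \<le> T \<longrightarrow> E b c \<le> \<epsilon> * W b c" "a \<le> b" "b \<le> c"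
      show "0 \<le> a \<and> c \<le> T \<longrightarrow> E a c \<le> \<epsilon> * W a c"
      proof
        assume ac: "0 \<le> a \<and> c \<le> T"
        have sub: "{a..c} \<subseteq> {0..T}" using ac by auto
        have "integral {a..b} ?w + integral {b..c} ?w = integral {a..c} ?w"
          using * integrable_on_subinterval[OF wi sub] by (intro Henstock_Kurzweil_Integration.integral_combine)
        moreover have "W a b + W b c = W a c"
          unfolding W_def
          using * integrable_on_subinterval[OF nui sub] by (intro Henstock_Kurzweil_Integration.integral_combine)
        then have "\<epsilon> * W a b + \<epsilon> * W b c = \<epsilon> * W a c" by (simp flip: distrib_left)
        moreover have "E a b \<le> \<epsilon> * W a b" "E b c \<le> \<epsilon> * W b c" using * ac by auto
        ultimately show "E a c \<le> \<epsilon> * W a c"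
          unfolding E_def by linarith
      qed
    next
      fix t assume t: "0 \<le> t" "t \<le> T"
      \<comment> \<open>The gradient is frozen at \<open>x t\<close>. One half of \<epsilon> pays
        for linearizing the increment of \<open>f\<close>, the other half for replacing
        \<open>grad f (x s)\<close> by \<open>c\<close> under the integral.\<close>
      define c where "c = grad f (x t)"
      obtain r where r: "0 < r" "\<And>z. dist z (x t) < r \<Longrightarrow> dist (grad f z) c < \<epsilon> / 2"
        using cont \<epsilon> unfolding continuous_on_iff c_def by (metis UNIV_I half_gt_zero)
      obtain d where d: "0 < d" "\<And>s. s \<in> {0..T} \<Longrightarrow> dist s t < d \<Longrightarrow> dist (x s) (x t) < r"
        using contx r(1) t unfolding continuous_on_iff by (metis atLeastAtMost_iff)
      show "\<exists>d>0. \<forall>a b. a \<le> t \<and> t \<le> b \<and> b - a < d \<longrightarrow> 0 \<le> a \<and> b \<le> T \<longrightarrow> E a b \<le> \<epsilon> * W a b"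
      proof (intro exI[of _ d] conjI allI impI d(1))
        fix a b assume *: "a \<le> t \<and> t \<le> b \<and> b - a < d" "0 \<le> a \<and> b \<le> T"
        have sub: "{a..b} \<subseteq> {0..T}" and sub': "{0..b} \<subseteq> {0..T}" using * by auto
        have near: "dist (x s) (x t) < r" if "s \<in> {a..b}" for s
          using that * by (intro d(2)) (auto simp: dist_real_def)
        note ui' = integrable_on_subinterval[OF ui sub] and nui' = integrable_on_subinterval[OF nui sub]
          and wi' = integrable_on_subinterval[OF wi sub]
        have xab: "x b - x a = integral {a..b} u"
          using Henstock_Kurzweil_Integration.integral_combine[of 0 a b u] integrable_on_subinterval[OF ui sub'] *
          by (auto simp: x diff_eq_eq add.commute)
        have "\<bar>f (x b) - f (x a) - (x b - x a) \<bullet> c\<bar> \<le> \<epsilon> / 2 * norm (x b - x a)"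
        proof (rule C1_increment_bound[OF diff convex_ball])
          show "x b \<in> ball (x t) r" "x a \<in> ball (x t) r"
            using near * by (auto simp: dist_commute)
          show "norm (grad f z - c) \<le> \<epsilon> / 2" if "z \<in> ball (x t) r" for z
            using r(2)[of z] that unfolding mem_ball dist_commute[of "x t"] by (simp add: dist_norm)
        qed
        also have "norm (x b - x a) \<le> W a b"
          unfolding xab W_def by (intro integral_norm_bound_integral ui' nui') simp
        finally have 1: "\<bar>f (x b) - f (x a) - (x b - x a) \<bullet> c\<bar> \<le> \<epsilon> / 2 * W a b"
          using \<epsilon> by simp
        have uc: "((\<lambda>s. u s \<bullet> c) has_integral ((x b - x a) \<bullet> c)) {a..b}"
          unfolding xab using has_integral_linear[OF integrable_integral[OF ui'] bounded_linear_inner_left[of c]]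
          by (simp add: o_def)
        have "norm (integral {a..b} (\<lambda>s. ?w s - u s \<bullet> c)) \<le> integral {a..b} (\<lambda>s. \<epsilon> / 2 * norm (u s))"
        proof (rule integral_norm_bound_integral)
          show "(\<lambda>s. ?w s - u s \<bullet> c) integrable_on {a..b}"
            using wi' uc by (intro integrable_diff) auto
          show "(\<lambda>s. \<epsilon> / 2 * norm (u s)) integrable_on {a..b}"
            using nui' by (rule integrable_on_mult_right)
          fix s assume "s \<in> {a..b}"
          then have "norm (grad f (x s) - c) \<le> \<epsilon> / 2"
            using r(2)[OF near] by (simp add: dist_norm less_imp_le)
          from mult_left_mono[OF this norm_ge_zero[of "u s"]]
          have "norm (u s) * norm (grad f (x s) - c) \<le> \<epsilon> / 2 * norm (u s)"
            by (simp add: mult.commute)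
          then show "norm (?w s - u s \<bullet> c) \<le> \<epsilon> / 2 * norm (u s)"
            using Cauchy_Schwarz_ineq2[of "u s" "grad f (x s) - c"] by (simp add: inner_diff_right)
        qed
        moreover have "integral {a..b} (\<lambda>s. ?w s - u s \<bullet> c) = integral {a..b} ?w - (x b - x a) \<bullet> c"
          using wi' uc by (subst Henstock_Kurzweil_Integration.integral_diff) (auto simp: integral_unique)
        ultimately have 2: "\<bar>integral {a..b} ?w - (x b - x a) \<bullet> c\<bar> \<le> \<epsilon> / 2 * W a b"
          by (simp add: W_def)
        show "E a b \<le> \<epsilon> * W a b"
          using 1 2 unfolding E_def by linarith
      qed
    qed
    then have "E 0 T \<le> \<epsilon> * W 0 T" by simp
    also have "\<dots> \<le> e" using W0 that by (simp add: \<epsilon>_def field_simps)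
    finally show ?thesis .
  qed
  then have "E 0 T \<le> 0" by (rule field_le_epsilon[of _ 0, simplified])
  then show "integral {0..T} ?w = f (x T) - f (x 0)" by (simp add: E_def)
qed

section \<open>Existence of solutions of descent equations\<close>

lemma primitive_has_vector_derivative:
  fixes h :: "real \<Rightarrow> 'a::euclidean_space"
  assumes "continuous_on {0..} h" "0 \<le> t"
  shows "((\<lambda>u. integral {0..u} h) has_vector_derivative h t) (at t within {0..})"
proof -
  have "((\<lambda>u. integral {0..u} h) has_vector_derivative h t) (at t within {0..t + 1})"
    using assms by (intro integral_has_vector_derivative continuous_on_subset[OF assms(1)]) auto
  moreover have "at t within {0..t + 1} = at t within {0..}"
    using assms(2) by (intro at_within_nhd[of _ "{..<t + 1}"]) auto
  ultimately show ?thesis by simp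
qed

lemma lipschitz_ode_solution_exists:
  fixes G :: "'a::euclidean_space \<Rightarrow> 'a"
  assumes lip: "L-lipschitz_on UNIV G" and bdd: "bounded (range G)"
  shows "\<exists>x. solves_ode G x0 x"
proof -
  \<comment> \<open>A strictly positive Lipschitz constant is wanted, since the bound on
    \<open>P g\<close> divides by \<open>2 * K\<close>.\<close>
  define K where "K = L + 1"
  have K: "0 < K" using lipschitz_on_nonneg[OF lip] by (simp add: K_def)
  have lipK: "norm (G a - G b) \<le> K * norm (a - b)" for a b
    using lipschitz_onD[OF lip, of a b] mult_right_mono[of L K "norm (a - b)"]
    by (simp add: dist_norm K_def)
  obtain M where M: "0 < M" "\<And>z. norm (G z) \<le> M"
    using bdd by (auto simp: bounded_pos)
  have contG: "continuous_on UNIV G" by (rule lipschitz_on_continuous_on[OF lip])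
  \<comment> \<open>In the unknown \<open>g t = exp (- 2 K t) (x t - x0)\<close> the integral equation is a contraction on
    bounded functions for the sup norm over all of \<open>[0, \<infinity>)\<close>, so no gluing of local solutions
    is needed.\<close>
  define h where "h g s = G (x0 + exp (2 * K * s) *\<^sub>R g s)" for g :: "real \<Rightarrow> 'a" and s
  \<comment> \<open>Bounded continuous functions live on the whole real line; \<open>max 0 t\<close>
    extends the operator constantly to negative times.\<close>
  define P where "P g t = exp (- (2 * K * max 0 t)) *\<^sub>R integral {0..max 0 t} (h g)" for g t
  have conth: "continuous_on A (h g)" if "continuous_on A g" for A g
    unfolding h_def by (rule continuous_on_compose2[OF contG]) (auto intro!: continuous_intros that)
  have inth: "h g integrable_on {0..b}" if "continuous_on UNIV g" for g b
    by (intro integrable_continuous_real conth continuous_on_subset[OF that]) simp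
  have P_bcontfun: "P g \<in> bcontfun" if g: "continuous_on UNIV g" for g
  proof (rule bcontfun_normI)
    have "continuous_on {0..} (\<lambda>u. integral {0..u} (h g))"
      unfolding continuous_on_eq_continuous_within
      using primitive_has_vector_derivative[OF conth[OF continuous_on_subset[OF g]]]
      by (auto intro: has_vector_derivative_continuous)
    then have "continuous_on UNIV (\<lambda>t. integral {0..max 0 t} (h g))"
      by (rule continuous_on_compose2) (auto intro!: continuous_intros max.cobounded1)
    then show "continuous_on UNIV (P g)"
      unfolding P_def by (intro continuous_intros)
  next
    fix t :: real
    define \<tau> where "\<tau> = max 0 t"
    have \<tau>: "0 \<le> \<tau>" unfolding \<tau>_def by (rule max.cobounded1)
    have "norm (integral {0..\<tau>} (h g)) \<le> M * (\<tau> - 0)"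
      using \<tau> by (intro integral_bound conth continuous_on_subset[OF g]) (auto simp: h_def M)
    then have "norm (P g t) \<le> exp (- (2 * K * \<tau>)) * (M * \<tau>)"
      by (simp add: P_def \<tau>_def)
    also have "\<dots> \<le> exp (- (2 * K * \<tau>)) * (M / (2 * K) * exp (2 * K * \<tau>))"
    proof -
      \<comment> \<open>The integral of the bounded field grows at most linearly in \<tau>, and the
        exponential weight absorbs this growth.\<close>
      have "2 * K * \<tau> \<le> exp (2 * K * \<tau>)" using exp_ge_add_one_self[of "2 * K * \<tau>"] by linarith
      then have "M / (2 * K) * (2 * K * \<tau>) \<le> M / (2 * K) * exp (2 * K * \<tau>)"
        using M K by (intro mult_left_mono) auto
      then have "M * \<tau> \<le> M / (2 * K) * exp (2 * K * \<tau>)" using K by simp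
      then show ?thesis by (rule mult_left_mono) simp
    qed
    also have "\<dots> = M / (2 * K)" by (simp add: exp_minus)
    finally show "norm (P g t) \<le> M / (2 * K)" .
  qed
  define T where "T g = Bcontfun (P (apply_bcontfun g))" for g :: "real \<Rightarrow>\<^sub>C 'a"
  have T: "apply_bcontfun (T g) = P (apply_bcontfun g)" for g
    unfolding T_def by (intro Bcontfun_inverse P_bcontfun continuous_on_apply_bcontfun)
  have "dist (T g1) (T g2) \<le> 1 / 2 * dist g1 g2" for g1 g2
  proof (rule dist_bound)
    fix t :: real
    define \<tau> where "\<tau> = max 0 t"
    define D where "D = dist g1 g2"
    have \<tau>: "0 \<le> \<tau>" unfolding \<tau>_def by (rule max.cobounded1)
    have D: "norm (apply_bcontfun g1 s - apply_bcontfun g2 s) \<le> D" for s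
      unfolding D_def dist_norm[symmetric] by (rule dist_bounded)
    note int = inth[OF continuous_on_apply_bcontfun]
    \<comment> \<open>The weight has rate \<open>2 * K\<close>, twice the Lipschitz constant, so
      integration produces the contraction factor 1/2.\<close>
    have exp_int: "((\<lambda>s. K * exp (2 * K * s) * D) has_integral (D / 2 * exp (2 * K * \<tau>) - D / 2 * exp (2 * K * 0))) {0..\<tau>}"
      using \<tau> by (intro fundamental_theorem_of_calculus)
        (auto intro!: derivative_eq_intros simp: has_real_derivative_iff_has_vector_derivative[symmetric])
    have "norm (integral {0..\<tau>} (\<lambda>s. h g1 s - h g2 s)) \<le> integral {0..\<tau>} (\<lambda>s. K * exp (2 * K * s) * D)"
    proof (rule integral_norm_bound_integral)
      fix s
      have "norm (h g1 s - h g2 s) \<le> K * norm (exp (2 * K * s) *\<^sub>R (apply_bcontfun g1 s - apply_bcontfun g2 s))"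
        using lipK[of "x0 + exp (2 * K * s) *\<^sub>R apply_bcontfun g1 s" "x0 + exp (2 * K * s) *\<^sub>R apply_bcontfun g2 s"]
        by (simp add: h_def scaleR_diff_right)
      also have "\<dots> \<le> K * exp (2 * K * s) * D"
        using D[of s] K by simp
      finally show "norm (h g1 s - h g2 s) \<le> K * exp (2 * K * s) * D" .
    qed (use exp_int in \<open>auto intro!: integrable_diff int\<close>)
    also have "\<dots> \<le> D / 2 * exp (2 * K * \<tau>)"
      using integral_unique[OF exp_int] zero_le_dist[of g1 g2] by (simp add: D_def)
    finally have "norm (integral {0..\<tau>} (h g1) - integral {0..\<tau>} (h g2)) \<le> D / 2 * exp (2 * K * \<tau>)"
      by (simp add: Henstock_Kurzweil_Integration.integral_diff int)
    then have "exp (- (2 * K * \<tau>)) * norm (integral {0..\<tau>} (h g1) - integral {0..\<tau>} (h g2))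
        \<le> exp (- (2 * K * \<tau>)) * (D / 2 * exp (2 * K * \<tau>))"
      by (rule mult_left_mono) simp
    also have "\<dots> = 1 / 2 * D" by (simp add: exp_minus)
    also have "exp (- (2 * K * \<tau>)) * norm (integral {0..\<tau>} (h g1) - integral {0..\<tau>} (h g2))
        = norm (P g1 t - P g2 t)"
      by (simp add: P_def \<tau>_def flip: scaleR_diff_right)
    finally show "dist (apply_bcontfun (T g1) t) (apply_bcontfun (T g2) t) \<le> 1 / 2 * dist g1 g2"
      unfolding D_def T dist_norm[of "P g1 t"] .
  qed
  then obtain g where "T g = g"
    using banach_fix_type[of "1/2" T] by auto
  then have fixpoint: "g t = P g t" for t using T by metis
  define x where "x t = x0 + integral {0..t} (h g)" for t
  have x: "x t = x0 + exp (2 * K * t) *\<^sub>R g t" if "0 \<le> t" for t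
    using that by (subst fixpoint) (simp add: P_def x_def max_absorb2 flip: exp_add)
  have "(x has_vector_derivative G (x t)) (at t within {0..})" if "0 \<le> t" for t
  proof -
    have "(x has_vector_derivative 0 + h g t) (at t within {0..})"
      unfolding x_def[abs_def]
      by (intro has_vector_derivative_add has_vector_derivative_const
          primitive_has_vector_derivative[OF conth[OF continuous_on_apply_bcontfun] that])
    then show ?thesis by (simp add: x[OF that] h_def)
  qed
  then show ?thesis
    by (intro exI[of _ x]) (simp add: solves_ode_def x_def)
qed

lemma antimono_on_nonneg_reals:
  fixes v :: "real \<Rightarrow> real"
  assumes der: "\<And>t. 0 \<le> t \<Longrightarrow> (v has_real_derivative d t) (at t within {0..})"
    and "\<And>t. 0 \<le> t \<Longrightarrow> d t \<le> 0" and "0 \<le> s" "s \<le> t"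
  shows "v t \<le> v s"
proof -
  have "\<exists>r\<in>{s..t}. v t - v s = (*) (d r) (t - s)"
  proof (rule mvt_very_simple[OF \<open>s \<le> t\<close>])
    fix r assume "s \<le> r" "r \<le> t"
    then show "(v has_derivative (*) (d r)) (at r within {s..t})"
      using has_field_derivative_subset[OF der, of r "{s..t}"] \<open>0 \<le> s\<close>
      by (auto simp: has_field_derivative_def)
  qed
  then obtain r where "r \<in> {s..t}" "v t - v s = d r * (t - s)" by auto
  then show ?thesis
    using mult_nonpos_nonneg[of "d r" "t - s"] assms by auto
qed

lemma descent_ode_solution_exists:
  fixes f :: "'a::euclidean_space \<Rightarrow> real"
  assumes diff: "\<And>z. f differentiable (at z)" and lev: "level_bounded f"
    and lip: "\<And>R. \<exists>L. L-lipschitz_on (cball 0 R) F"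
    and descent: "\<And>z. F z \<bullet> grad f z \<le> 0"
  shows "\<exists>x. solves_ode F x0 x"
proof -
  obtain R where R: "0 < R" "\<And>z. f z \<le> f x0 \<Longrightarrow> norm z \<le> R"
    using lev unfolding level_bounded_def bounded_pos by (metis mem_Collect_eq)
  let ?S = "cball (0::'a) (R + 1)"
  obtain L where L: "L-lipschitz_on ?S F" using lip by blast
  \<comment> \<open>Composition with the nonexpansive projection onto the ball makes the Lipschitz
    bound global. Wherever \<open>H\<close> may differ from \<open>F\<close>, the factor
    \<open>cut\<close> introduced below vanishes.\<close>
  define H where "H z = F (closest_point ?S z)" for z
  have cpS: "closest_point ?S z \<in> ?S" for z
    using R(1) by (intro closest_point_in_set) auto
  have "norm (closest_point ?S a - closest_point ?S b) \<le> norm (a - b)" for a b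
    using closest_point_lipschitz[of ?S a b] R(1) by (simp add: dist_norm)
  then have lipH: "norm (H a - H b) \<le> L * norm (a - b)" for a b
    unfolding H_def using lipschitz_on_normD[OF L cpS cpS] lipschitz_on_nonneg[OF L]
    by (meson mult_left_mono order_trans)
  have "bounded (F ` ?S)"
    by (intro compact_imp_bounded compact_continuous_image lipschitz_on_continuous_on[OF L]) simp
  then obtain M where M: "0 < M" "\<And>z. norm (H z) \<le> M"
    unfolding bounded_pos H_def using cpS by blast
  \<comment> \<open>Cutting off outside the sublevel set of \<open>x0\<close> gives a bounded Lipschitz field along which
    \<open>f\<close> still decreases, so its solution never leaves the region where the field is \<open>F\<close>.\<close>
  define cut where "cut z = max 0 (min 1 (R + 1 - norm z))" for z :: 'a
  have cut: "0 \<le> cut z" "cut z \<le> 1" for z by (auto simp: cut_def)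
  define G where "G z = cut z *\<^sub>R H z" for z
  have "(L + M)-lipschitz_on UNIV G"
  proof (rule lipschitz_onI)
    fix a b :: 'a
    \<comment> \<open>The splitting is that of a product rule: \<open>H\<close> varies by its
      Lipschitz bound under a factor at most 1, and \<open>cut\<close> is 1-Lipschitz against the
      bound \<open>M\<close> on \<open>H\<close>.\<close>
    have "G a - G b = cut a *\<^sub>R (H a - H b) + (cut a - cut b) *\<^sub>R H b"
      by (simp add: G_def algebra_simps)
    then have "norm (G a - G b) \<le> cut a * norm (H a - H b) + \<bar>cut a - cut b\<bar> * norm (H b)"
      using norm_triangle_ineq[of "cut a *\<^sub>R (H a - H b)" "(cut a - cut b) *\<^sub>R H b"] cut by simp
    also have "\<dots> \<le> 1 * (L * norm (a - b)) + norm (a - b) * M"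
    proof (intro add_mono mult_mono lipH M cut)
      show "\<bar>cut a - cut b\<bar> \<le> norm (a - b)"
        using norm_triangle_ineq3[of a b] unfolding cut_def by linarith
    qed auto
    finally show "dist (G a) (G b) \<le> (L + M) * dist a b"
      by (simp add: dist_norm algebra_simps)
  qed (use M lipschitz_on_nonneg[OF L] in simp)
  moreover have "bounded (range G)"
  proof (rule boundedI)
    fix z assume "z \<in> range G"
    then obtain y where "z = G y" by auto
    then show "norm z \<le> M"
      using mult_mono[OF cut(2) M(2)] cut by (simp add: G_def)
  qed
  ultimately obtain x where x: "solves_ode G x0 x"
    using lipschitz_ode_solution_exists by blast
  have in_S: "H z = F z" if "norm z \<le> R + 1" for z
    using that by (simp add: H_def closest_point_self)
  have descG: "G z \<bullet> grad f z \<le> 0" for z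
  proof (cases "norm z \<le> R + 1")
    case True then show ?thesis
      using descent[of z] cut(1)[of z] by (simp add: G_def in_S mult_nonneg_nonpos)
  qed (simp add: G_def cut_def)
  have "f (x t) \<le> f (x 0)" if "0 \<le> t" for t
  proof (rule antimono_on_nonneg_reals[of "\<lambda>t. f (x t)" "\<lambda>t. G (x t) \<bullet> grad f (x t)"])
    fix t :: real assume "0 \<le> t"
    then have "(x has_vector_derivative G (x t)) (at t within {0..})"
      using x by (simp add: solves_ode_def)
    then show "((\<lambda>t. f (x t)) has_real_derivative G (x t) \<bullet> grad f (x t)) (at t within {0..})"
      by (rule GDERIV_has_vector_derivative[OF GDERIV_grad[OF diff]])
  qed (use that descG in auto)
  then have "norm (x t) \<le> R" if "0 \<le> t" for t
    using that x R(2) by (simp add: solves_ode_def)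
  then have "G (x t) = F (x t)" if "0 \<le> t" for t
    using that in_S[of "x t"] by (force simp: G_def cut_def)
  then show ?thesis
    using x by (intro exI[of _ x]) (simp add: solves_ode_def)
qed

section \<open>The control problem\<close>

locale optimal_control = strongly_convex_penalty \<phi> \<mu>
  for \<phi> :: "'a::euclidean_space \<Rightarrow> ereal" and \<mu> :: real +
  fixes f :: "'a \<Rightarrow> real" and xs :: 'a
  assumes C2: "C2_function f"
    and level: "level_bounded f"
    and sconvex: "strictly_convex f"
    and xs_def: "xs = (THE x. is_arg_min f (\<lambda>_. True) x)"
    and smooth: "essentially_smooth \<phi>"
    and even: "\<phi> (- x) = \<phi> x"
begin

section \<open>The minimizer and the growth of the objective\<close>

lemma diff: "f differentiable (at z)"
  using C2 by (simp add: C2_function_def)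

lemma has_derivative_f: "(f has_derivative (\<lambda>h. h \<bullet> grad f z)) (at z)"
  using GDERIV_grad[OF diff] by (simp add: gderiv_def)

lemma cont_f: "continuous_on A f"
  using has_derivative_f has_derivative_continuous
  by (meson continuous_at_imp_continuous_on)

lemma cont_grad: "continuous_on A (grad f)"
  using C2 has_derivative_continuous unfolding C2_function_def
  by (meson continuous_at_imp_continuous_on)

lemma compact_sublevel: "compact {z. f z \<le> c}"
  using level cont_f closed_Collect_le[OF cont_f continuous_on_const]
  by (simp add: compact_eq_bounded_closed level_bounded_def)

text \<open>A compact sublevel set provides a global minimizer, and the midpoint with any second
  minimizer would lie strictly lower. Hence the \<open>THE\<close> in \<open>xs_def\<close> denotes
  this point.\<close>

lemma xs_less:
  assumes "z \<noteq> xs" shows "f xs < f z"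
proof -
  obtain m where m: "m \<in> {z. f z \<le> f 0}" "\<And>z. f z \<le> f 0 \<Longrightarrow> f m \<le> f z"
    using continuous_attains_inf[OF compact_sublevel[of "f 0"] _ cont_f] by auto
  have le: "f m \<le> f z" for z
    using m(1) m(2)[of z] by (cases "f z \<le> f 0") auto
  have less: "f m < f z" if "z \<noteq> m" for z
  proof (rule ccontr)
    assume "\<not> f m < f z"
    then have "f z = f m" using le[of z] by simp
    moreover have "f ((1 - 1/2) *\<^sub>R m + (1/2) *\<^sub>R z) < (1 - 1/2) * f m + 1/2 * f z"
      using sconvex[unfolded strictly_convex_def, rule_format, of m z "1/2"] that by simp
    ultimately show False using le[of "(1 - 1/2) *\<^sub>R m + (1/2) *\<^sub>R z"] by simp
  qed
  have "xs = m"
    unfolding xs_def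
  proof (rule the_equality)
    show "is_arg_min f (\<lambda>_. True) m"
      using le by (simp add: is_arg_min_def not_less)
    show "z = m" if "is_arg_min f (\<lambda>_. True) z" for z
      using that less[of z] by (cases "z = m") (auto simp: is_arg_min_def)
  qed
  then show ?thesis using less assms by simp
qed

lemma xs_le: "f xs \<le> f z"
  using xs_less[of z] by (cases "z = xs") auto

lemma grad_xs: "grad f xs = 0"
proof -
  have "(\<lambda>h. h \<bullet> grad f xs) = (\<lambda>h. 0)"
    using differential_zero_maxmin[OF _ open_UNIV has_derivative_f] xs_le by blast
  then have "grad f xs \<bullet> grad f xs = 0" by metis
  then show ?thesis by simp
qed

lemma above_tangent: "f z + grad f z \<bullet> (y - z) \<le> f y"
  by (rule strictly_convex_above_tangent[OF sconvex diff])

lemma grad_nonzero: "z \<noteq> xs \<Longrightarrow> grad f z \<noteq> 0"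
  using above_tangent[of z xs] xs_less[of z] by auto

lemma bregman_xs: "bregman f z xs = f z - f xs"
  by (simp add: bregman_def grad_xs)

text \<open>On the sphere of radius \<open>e\<close> the minimum of \<open>f\<close> is strictly
  above \<open>f xs\<close>; convexity along rays from \<open>xs\<close> propagates this excess
  outward at least linearly.\<close>

lemma linear_growth:
  assumes "0 < e"
  obtains m where "0 < m" "\<And>z. e \<le> norm (z - xs) \<Longrightarrow> m * norm (z - xs) \<le> f z - f xs"
proof -
  have "sphere xs e \<noteq> {}" using assms by simp
  then obtain p where p: "p \<in> sphere xs e" "\<And>z. z \<in> sphere xs e \<Longrightarrow> f p \<le> f z"
    using continuous_attains_inf[OF compact_sphere _ cont_f] by blast
  define m where "m = (f p - f xs) / e"
  have "p \<noteq> xs" using p(1) assms by auto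
  then have "0 < m" using xs_less assms by (simp add: m_def)
  moreover have "m * norm (z - xs) \<le> f z - f xs" if "e \<le> norm (z - xs)" for z
  proof (cases "norm (z - xs) = e")
    case True
    then show ?thesis using p(2)[of z] assms by (simp add: m_def dist_norm norm_minus_commute)
  next
    case False
    define d where "d = norm (z - xs)"
    have d: "e < d" "0 < d" using that False assms by (auto simp: d_def)
    \<comment> \<open>This is where the segment from \<open>xs\<close> to \<open>z\<close> meets the
      sphere of radius \<open>e\<close>.\<close>
    let ?y = "(1 - e / d) *\<^sub>R xs + (e / d) *\<^sub>R z"
    have "?y - xs = (e / d) *\<^sub>R (z - xs)" by (simp add: algebra_simps)
    then have "norm (?y - xs) = e" using d assms by (simp add: d_def)
    then have "f p \<le> f ?y" by (intro p(2)) (simp add: dist_norm norm_minus_commute)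
    moreover have "xs \<noteq> z" using d by (auto simp: d_def)
    then have "f ?y < (1 - e / d) * f xs + e / d * f z"
      using sconvex[unfolded strictly_convex_def, rule_format, of xs z "e / d"] d assms by simp
    ultimately have "f p - f xs \<le> e / d * (f z - f xs)" by (simp add: algebra_simps)
    then show ?thesis using d assms by (simp add: m_def field_simps flip: d_def)
  qed
  ultimately show ?thesis using that by blast
qed

lemma tendsto_xs_if_value_tendsto:
  assumes "((\<lambda>t. f (x t)) \<longlongrightarrow> f xs) F"
  shows "(x \<longlongrightarrow> xs) F"
proof (rule tendstoI)
  fix e :: real assume "0 < e"
  obtain m where m: "0 < m" "\<And>z. e \<le> norm (z - xs) \<Longrightarrow> m * norm (z - xs) \<le> f z - f xs"
    using linear_growth[OF \<open>0 < e\<close>] by blast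
  have "eventually (\<lambda>t. f (x t) < f xs + m * e) F"
    using assms m(1) \<open>0 < e\<close> by (intro order_tendstoD) auto
  then show "eventually (\<lambda>t. dist (x t) xs < e) F"
  proof eventually_elim
    case (elim t)
    show ?case
    proof (rule ccontr)
      assume "\<not> dist (x t) xs < e"
      then have "e \<le> norm (x t - xs)" by (simp add: dist_norm)
      then have "m * e \<le> f (x t) - f xs"
        using m(2)[of "x t"] mult_left_mono[of e "norm (x t - xs)" m] m(1) by linarith
      with elim show False by simp
    qed
  qed
qed

text \<open>The tangent inequality bounds the excess of \<open>f\<close> by the gradient norm times
  the distance to \<open>xs\<close>. Once the gradient norm is below the growth slope
  \<open>m\<close>, this distance is at most 1, so the gradient norm alone bounds the
  excess.\<close>

lemma value_tendsto_if_grad_tendsto: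
  assumes "((\<lambda>t. grad f (x t)) \<longlongrightarrow> 0) F"
  shows "((\<lambda>t. f (x t)) \<longlongrightarrow> f xs) F"
proof -
  obtain m where m: "0 < m" "\<And>z. 1 \<le> norm (z - xs) \<Longrightarrow> m * norm (z - xs) \<le> f z - f xs"
    using linear_growth[of 1] by auto
  have up: "f z - f xs \<le> norm (grad f z) * norm (z - xs)" for z
    using above_tangent[of z xs] norm_cauchy_schwarz[of "grad f z" "z - xs"]
    by (simp add: inner_diff_right)
  have normlim: "((\<lambda>t. norm (grad f (x t))) \<longlongrightarrow> 0) F"
    using tendsto_norm[OF assms] by simp
  then have "eventually (\<lambda>t. norm (grad f (x t)) < m) F"
    using m(1) by (rule order_tendstoD)
  then have "eventually (\<lambda>t. norm (f (x t) - f xs) \<le> norm (grad f (x t))) F"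
  proof eventually_elim
    case (elim t)
    have "norm (x t - xs) \<le> 1"
    proof (rule ccontr)
      assume *: "\<not> norm (x t - xs) \<le> 1"
      then have "m * norm (x t - xs) \<le> norm (grad f (x t)) * norm (x t - xs)"
        using m(2)[of "x t"] up[of "x t"] by linarith
      moreover have "0 < norm (x t - xs)" using * by linarith
      ultimately show False using elim by simp
    qed
    then have "norm (grad f (x t)) * norm (x t - xs) \<le> norm (grad f (x t))"
      by (simp add: mult_left_le)
    then show ?case using up[of "x t"] xs_le[of "x t"] by simp
  qed
  then have "((\<lambda>t. f (x t) - f xs) \<longlongrightarrow> 0) F"
    using normlim by (rule Lim_null_comparison)
  then show ?thesis by (simp add: LIM_zero_iff)
qed

section \<open>Lower bounds for the cost of stabilizing controls\<close>

lemma stabilizing_trajectory: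
  assumes "stabilizing_control f x0 u" "0 \<le> t"
  shows "trajectory x0 u t = x0 + integral {0..t} u"
  using assms set_lebesgue_integral_eq_integral(2)[of "{0..t}" u]
  by (simp add: trajectory_def stabilizing_control_def)

lemma cost_lower_bound:
  assumes u: "stabilizing_control f x0 u" and "0 \<le> t"
  shows "ereal (f x0 - f (trajectory x0 u t)) \<le> cost_on {0..t} f \<phi> x0 u"
proof -
  let ?x = "trajectory x0 u"
  let ?w = "\<lambda>s. - (u s \<bullet> grad f (?x s))"
  define N where "N = (\<integral>\<^sup>+ s \<in> {0..t}. e2ennreal (stage_cost f \<phi> (?x s) (u s)) \<partial>lebesgue)"
  have ui: "u absolutely_integrable_on {0..t}"
    using assms by (simp add: stabilizing_control_def)
  have x: "?x s = x0 + integral {0..s} u" if "s \<in> {0..t}" for s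
    using stabilizing_trajectory[OF u] that by simp
  note chain = chain_rule_primitive[OF diff cont_grad ui \<open>0 \<le> t\<close> x]
  have "set_lebesgue_integral lebesgue {0..t} ?w = - set_lebesgue_integral lebesgue {0..t} (\<lambda>s. u s \<bullet> grad f (?x s))"
    using chain(1) by (intro set_integral_uminus)
  also have "\<dots> = f x0 - f (?x t)"
    using chain set_lebesgue_integral_eq_integral(2)[OF chain(1)] x[of 0] \<open>0 \<le> t\<close> by simp
  finally have int: "(LINT s|lebesgue. indicator {0..t} s *\<^sub>R ?w s) = f x0 - f (?x t)"
    by (simp add: set_lebesgue_integral_def)
  have "(\<integral>\<^sup>+ s. ennreal (indicator {0..t} s *\<^sub>R ?w s) \<partial>lebesgue) \<le> N"
    unfolding N_def
  proof (rule nn_integral_mono)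
    fix s
    have "ereal (?w s) \<le> stage_cost f \<phi> (?x s) (u s)"
      using fenchel_young[of "- u s" "grad f (?x s)"] by (simp add: stage_cost_def)
    then have "ennreal (?w s) \<le> e2ennreal (stage_cost f \<phi> (?x s) (u s))"
      by (metis e2ennreal_ereal e2ennreal_mono)
    then show "ennreal (indicator {0..t} s *\<^sub>R ?w s)
        \<le> e2ennreal (stage_cost f \<phi> (?x s) (u s)) * indicator {0..t} s"
      by (auto split: split_indicator)
  qed
  \<comment> \<open>The integrand \<open>?w\<close> may be negative, and \<open>ennreal\<close>
    truncates it at 0. This only enlarges the integral, so a finite bound on the truncated integral
    also bounds the signed one.\<close>
  moreover have "f x0 - f (?x t) \<le> r"
    if "0 \<le> r" "(\<integral>\<^sup>+ s. ennreal (indicator {0..t} s *\<^sub>R ?w s) \<partial>lebesgue) \<le> ennreal r" for r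
    using integral_real_bounded[OF that] int by simp
  ultimately show ?thesis
    unfolding cost_on_def N_def[symmetric]
    by (cases N) (auto simp: enn2ereal_ennreal)
qed

lemma cost_on_mono: "A \<subseteq> B \<Longrightarrow> cost_on A f \<phi> x0 u \<le> cost_on B f \<phi> x0 u"
  unfolding cost_on_def less_eq_ennreal.rep_eq[symmetric] by (rule nn_set_integral_set_mono)

text \<open>The horizon tends to infinity in \<open>cost_lower_bound\<close>, the vanishing gradient
  forcing the terminal value down to \<open>f xs\<close>.\<close>

lemma total_cost_lower_bound:
  assumes u: "stabilizing_control f x0 u"
  shows "ereal (f x0 - f xs) \<le> J_infinity f \<phi> x0 u"
proof (rule tendsto_upperbound)
  have "((\<lambda>t. f (trajectory x0 u t)) \<longlongrightarrow> f xs) at_top"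
    using u by (intro value_tendsto_if_grad_tendsto) (simp add: stabilizing_control_def)
  then show "((\<lambda>t. ereal (f x0 - f (trajectory x0 u t))) \<longlongrightarrow> ereal (f x0 - f xs)) at_top"
    by (intro tendsto_intros)
  show "\<forall>\<^sub>F t in at_top. ereal (f x0 - f (trajectory x0 u t)) \<le> J_infinity f \<phi> x0 u"
    using eventually_ge_at_top[of 0]
  proof eventually_elim
    case (elim t)
    show ?case
      using cost_lower_bound[OF u elim] cost_on_mono[of "{0..t}" "{0..}"] by (auto intro: order_trans)
  qed
qed simp

section \<open>The closed-loop vector field\<close>

abbreviation "F \<equiv> closed_loop_field f \<phi>"

lemma F_eq: "F z = - argmax (grad f z)"
  by (simp add: closed_loop_field_def egrad_conjugate)

lemma F_descent: "F z \<bullet> grad f z \<le> 0"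
  using inner_argmax_nonneg by (simp add: F_eq)

lemma F_strict_descent: "z \<noteq> xs \<Longrightarrow> F z \<bullet> grad f z < 0"
  using inner_argmax_pos[OF smooth even grad_nonzero] by (simp add: F_eq)

lemma lipschitz_argmax: "(1 / \<mu>)-lipschitz_on A argmax"
  using argmax_lipschitz mu_pos by (intro lipschitz_onI) (auto simp: dist_norm)

lemma cont_F: "continuous_on A F"
  unfolding F_eq[abs_def]
  by (intro continuous_on_minus continuous_on_compose2[OF lipschitz_on_continuous_on[OF lipschitz_argmax, of UNIV] cont_grad]) simp

text \<open>The Hessian is bounded on a compact ball, so \<open>grad f\<close> is Lipschitz there,
  and \<open>argmax\<close> is globally Lipschitz.\<close>

lemma lipschitz_F: "\<exists>L. L-lipschitz_on (cball 0 R) F"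
proof -
  obtain H :: "'a \<Rightarrow> 'a \<Rightarrow>\<^sub>L 'a" where H: "\<And>x. (grad f has_derivative blinfun_apply (H x)) (at x)"
    and contH: "continuous_on UNIV H"
    using C2 by (auto simp: C2_function_def)
  have "bounded (H ` cball 0 R)"
    by (intro compact_imp_bounded compact_continuous_image continuous_on_subset[OF contH]) auto
  then obtain B where B: "0 < B" "\<And>z. z \<in> cball 0 R \<Longrightarrow> norm (H z) \<le> B"
    unfolding bounded_pos by blast
  have "B-lipschitz_on (cball 0 R) (grad f)"
  proof (rule lipschitz_onI)
    fix y z :: 'a assume "y \<in> cball 0 R" "z \<in> cball 0 R"
    then show "dist (grad f y) (grad f z) \<le> B * dist y z"
      unfolding dist_norm using B(2)
      by (intro differentiable_bound[OF convex_cball[of 0 R] has_derivative_at_withinI[OF H]]) (auto simp: norm_blinfun.rep_eq)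
  qed (use B in simp)
  from lipschitz_on_minus[OF lipschitz_on_compose[OF this lipschitz_argmax]] show ?thesis
    by (auto simp: o_def F_eq[abs_def])
qed

lemma closed_loop_solution_exists: "\<exists>x. solves_ode F x0 x"
  by (rule descent_ode_solution_exists[OF diff level lipschitz_F F_descent])

section \<open>Convergence and cost along a closed-loop solution\<close>

context
  fixes x0 :: 'a and x :: "real \<Rightarrow> 'a"
  assumes sol: "solves_ode F x0 x"
begin

lemma x_0: "x 0 = x0"
  and x_deriv: "0 \<le> t \<Longrightarrow> (x has_vector_derivative F (x t)) (at t within {0..})"
  using sol by (auto simp: solves_ode_def)

lemma value_deriv:
  "0 \<le> t \<Longrightarrow> ((\<lambda>t. f (x t)) has_real_derivative F (x t) \<bullet> grad f (x t)) (at t within {0..})"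
  by (rule GDERIV_has_vector_derivative[OF GDERIV_grad[OF diff] x_deriv])

lemma value_antimono: "0 \<le> s \<Longrightarrow> s \<le> t \<Longrightarrow> f (x t) \<le> f (x s)"
  by (rule antimono_on_nonneg_reals[OF value_deriv]) (auto simp: F_descent)

text \<open>If the values stayed above some \<open>c > f xs\<close>, the solution would remain in a
  compact set avoiding \<open>xs\<close>. There the descent rate has a positive minimum, and
  decrease at that rate would pass below \<open>f xs\<close> in finite time.\<close>

lemma value_tendsto: "((\<lambda>t. f (x t)) \<longlongrightarrow> f xs) at_top"
proof (rule order_tendstoI)
  fix c assume "c < f xs"
  then show "eventually (\<lambda>t. c < f (x t)) at_top"
    using xs_le by (intro always_eventually allI) (rule less_le_trans)
next
  fix c assume c: "f xs < c"
  have "\<exists>T\<ge>0. f (x T) < c"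
  proof (rule ccontr)
    assume "\<not> ?thesis"
    then have ge: "c \<le> f (x t)" if "0 \<le> t" for t using that by (auto simp: not_less)
    define K where "K = {z. f z \<le> f x0} \<inter> {z. c \<le> f z}"
    have K: "compact K"
      unfolding K_def using closed_Collect_le[OF continuous_on_const cont_f]
      by (intro compact_Int_closed compact_sublevel)
    have xK: "x t \<in> K" if "0 \<le> t" for t
      using value_antimono[of 0 t] ge that by (simp add: K_def x_0)
    have "continuous_on K (\<lambda>z. - (F z \<bullet> grad f z))"
      by (intro continuous_intros cont_F cont_grad)
    then obtain p where p: "p \<in> K" "\<And>z. z \<in> K \<Longrightarrow> - (F p \<bullet> grad f p) \<le> - (F z \<bullet> grad f z)"
      using continuous_attains_inf[OF K] xK[of 0] by blast
    define m where "m = - (F p \<bullet> grad f p)"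
    have "p \<noteq> xs" using p(1) c by (auto simp: K_def)
    then have m: "0 < m" using F_strict_descent by (simp add: m_def)
    \<comment> \<open>At this time the guaranteed decrease \<open>m * t\<close> exceeds the
      available \<open>f x0 - f xs\<close> by \<open>m\<close>.\<close>
    define t where "t = (f x0 - f xs) / m + 1"
    have t: "0 \<le> t" using m xs_le[of x0] by (simp add: t_def)
    have "f (x t) + m * t \<le> f (x 0) + m * 0"
    proof (rule antimono_on_nonneg_reals[of "\<lambda>t. f (x t) + m * t" "\<lambda>t. F (x t) \<bullet> grad f (x t) + m"])
      show "((\<lambda>t. f (x t) + m * t) has_real_derivative F (x t) \<bullet> grad f (x t) + m) (at t within {0..})"
        if "0 \<le> t" for t
        using value_deriv[OF that] by (auto intro!: derivative_eq_intros)
      show "F (x t) \<bullet> grad f (x t) + m \<le> 0" if "0 \<le> t" for t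
        using p(2)[OF xK[OF that]] by (simp add: m_def)
    qed (use t in auto)
    moreover have "m * t = f x0 - f xs + m" using m by (simp add: t_def field_simps)
    ultimately show False using xs_le[of "x t"] m by (simp add: x_0)
  qed
  then obtain T where "0 \<le> T" "f (x T) < c" by blast
  then show "eventually (\<lambda>t. f (x t) < c) at_top"
    using value_antimono[of T] by (intro eventually_at_top_linorderI[of T]) (auto intro: le_less_trans)
qed

lemma cont_x: "continuous_on {0..} x"
  unfolding continuous_on_eq_continuous_within
  using x_deriv by (auto intro: has_vector_derivative_continuous)

lemma cont_control: "continuous_on {0..} (\<lambda>t. F (x t))"
  by (rule continuous_on_compose2[OF cont_F[of UNIV] cont_x]) simp

lemma control_integrable: "(\<lambda>t. F (x t)) absolutely_integrable_on {0..T}"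
  by (intro absolutely_integrable_continuous_real continuous_on_subset[OF cont_control]) auto

lemma integral_control: "0 \<le> t \<Longrightarrow> integral {0..t} (\<lambda>t. F (x t)) = x t - x0"
  unfolding x_0[symmetric]
  by (intro integral_unique fundamental_theorem_of_calculus has_vector_derivative_within_subset[OF x_deriv]) auto

lemma trajectory_closed_loop: "0 \<le> t \<Longrightarrow> trajectory x0 (\<lambda>t. F (x t)) t = x t"
  using set_lebesgue_integral_eq_integral(2)[OF control_integrable[of t]]
  by (simp add: trajectory_def integral_control)

lemma closed_loop_stabilizing: "stabilizing_control f x0 (\<lambda>t. F (x t))"
  unfolding stabilizing_control_def
proof (intro conjI allI impI control_integrable)
  show "(\<lambda>t. F (x t)) \<in> borel_measurable (lebesgue_on {0..})"
    using cont_control by (rule continuous_imp_measurable_on_sets_lebesgue) simp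
  have "isCont (grad f) xs"
    using cont_grad[of UNIV] by (simp add: continuous_on_eq_continuous_at)
  then have "((\<lambda>t. grad f (x t)) \<longlongrightarrow> grad f xs) at_top"
    by (rule isCont_tendsto_compose) (rule tendsto_xs_if_value_tendsto[OF value_tendsto])
  moreover have "eventually (\<lambda>t. grad f (trajectory x0 (\<lambda>t. F (x t)) t) = grad f (x t)) at_top"
    using eventually_ge_at_top[of 0] by eventually_elim (simp add: trajectory_closed_loop)
  ultimately show "((\<lambda>t. grad f (trajectory x0 (\<lambda>t. F (x t)) t)) \<longlongrightarrow> 0) at_top"
    by (simp add: tendsto_cong grad_xs)
qed

text \<open>Equality in Fenchel-Young turns the stage cost into the descent rate of
  \<open>f\<close>, whose integral up to time n is at most \<open>f x0 - f xs\<close>. Monotone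
  convergence in n gives the upper bound; the lower bound is the one for all stabilizing
  controls.\<close>

lemma closed_loop_total_cost: "J_infinity f \<phi> x0 (\<lambda>t. F (x t)) = ereal (f x0 - f xs)"
proof (rule antisym)
  define w where "w s = - (F (x s) \<bullet> grad f (x s))" for s
  have w_nonneg: "0 \<le> w s" for s using F_descent by (simp add: w_def)
  have contw: "continuous_on {0..} w"
    unfolding w_def
    by (intro continuous_intros cont_control continuous_on_compose2[OF cont_grad[of UNIV] cont_x]) simp
  have wa: "w absolutely_integrable_on {0..real n}" for n
    by (intro absolutely_integrable_continuous_real continuous_on_subset[OF contw]) auto
  have int: "(\<integral>\<^sup>+ s \<in> {0..real n}. ennreal (w s) \<partial>lebesgue) \<le> ennreal (f x0 - f xs)" for n
  proof -
    have "(\<integral>\<^sup>+ s \<in> {0..real n}. ennreal (w s) \<partial>lebesgue)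
        = (\<integral>\<^sup>+ s. ennreal (indicator {0..real n} s *\<^sub>R w s) \<partial>lebesgue)"
      by (intro nn_integral_cong) (auto split: split_indicator)
    also have "\<dots> = ennreal (LINT s:{0..real n}|lebesgue. w s)"
      unfolding set_lebesgue_integral_def using wa[of n] w_nonneg
      by (intro nn_integral_eq_integral) (auto simp: set_integrable_def)
    also have "(LINT s:{0..real n}|lebesgue. w s) = integral {0..real n} w"
      by (rule set_lebesgue_integral_eq_integral(2)[OF wa])
    also have "\<dots> = f x0 - f (x (real n))"
    proof -
      have "((\<lambda>s. F (x s) \<bullet> grad f (x s)) has_integral (f (x (real n)) - f (x 0))) {0..real n}"
        by (intro fundamental_theorem_of_calculus)
          (auto simp: has_real_derivative_iff_has_vector_derivative[symmetric]
            intro!: has_field_derivative_subset[OF value_deriv])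
      from integral_unique[OF has_integral_neg[OF this]] show ?thesis
        by (simp add: w_def[abs_def] x_0)
    qed
    finally show ?thesis using xs_le[of "x (real n)"] by (simp add: ennreal_leI)
  qed
  have "cost_on {0..} f \<phi> x0 (\<lambda>t. F (x t)) = enn2ereal (\<integral>\<^sup>+ s \<in> {0..}. ennreal (w s) \<partial>lebesgue)"
    unfolding cost_on_def
  proof (intro arg_cong[where f=enn2ereal] nn_integral_cong)
    fix s :: real
    have "stage_cost f \<phi> (trajectory x0 (\<lambda>t. F (x t)) s) (F (x s)) = ereal (w s)" if "0 \<le> s"
      unfolding trajectory_closed_loop[OF that]
      using fenchel_young_argmax by (simp add: stage_cost_def w_def F_eq)
    then show "e2ennreal (stage_cost f \<phi> (trajectory x0 (\<lambda>t. F (x t)) s) (F (x s))) * indicator {0..} s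
        = ennreal (w s) * indicator {0..} s"
      by (auto split: split_indicator)
  qed
  also have "(\<integral>\<^sup>+ s \<in> {0..}. ennreal (w s) \<partial>lebesgue)
      = (\<integral>\<^sup>+ s. (SUP n. ennreal (w s) * indicator {0..real n} s) \<partial>lebesgue)"
  proof (intro nn_integral_cong antisym)
    fix s
    obtain n where "s \<le> real n" using real_arch_simple by blast
    then have "ennreal (w s) * indicator {0..} s \<le> ennreal (w s) * indicator {0..real n} s"
      by (auto split: split_indicator)
    also have "\<dots> \<le> (SUP n. ennreal (w s) * indicator {0..real n} s)" by (rule SUP_upper) simp
    finally show "ennreal (w s) * indicator {0..} s \<le> (SUP n. ennreal (w s) * indicator {0..real n} s)" .
    show "(SUP n. ennreal (w s) * indicator {0..real n} s) \<le> ennreal (w s) * indicator {0..} s"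
      by (rule SUP_least) (auto split: split_indicator)
  qed
  also have "\<dots> = (SUP n. \<integral>\<^sup>+ s. ennreal (w s) * indicator {0..real n} s \<partial>lebesgue)"
  proof (rule nn_integral_monotone_convergence_SUP)
    show "incseq (\<lambda>n s. ennreal (w s) * indicator {0..real n} s)"
      by (auto simp: incseq_def le_fun_def split: split_indicator)
    fix n
    have "(\<lambda>s. indicator {0..real n} s *\<^sub>R w s) \<in> borel_measurable lebesgue"
      using wa[of n] unfolding set_integrable_def by (rule borel_measurable_integrable)
    then have "(\<lambda>s. ennreal (indicator {0..real n} s *\<^sub>R w s)) \<in> borel_measurable lebesgue"
      by measurable
    moreover have "(\<lambda>s. ennreal (indicator {0..real n} s *\<^sub>R w s)) = (\<lambda>s. ennreal (w s) * indicator {0..real n} s)"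
      by (auto split: split_indicator)
    ultimately show "(\<lambda>s. ennreal (w s) * indicator {0..real n} s) \<in> borel_measurable lebesgue" by simp
  qed
  also have "enn2ereal \<dots> \<le> enn2ereal (ennreal (f x0 - f xs))"
    unfolding less_eq_ennreal.rep_eq[symmetric] by (rule SUP_least) (rule int)
  also have "\<dots> = ereal (f x0 - f xs)" using xs_le by (simp add: enn2ereal_ennreal)
  finally show "J_infinity f \<phi> x0 (\<lambda>t. F (x t)) \<le> ereal (f x0 - f xs)" .
qed (rule total_cost_lower_bound[OF closed_loop_stabilizing])

lemma closed_loop_optimal: "optimal_stabilizing_control f \<phi> x0 (\<lambda>t. F (x t))"
  unfolding optimal_stabilizing_control_def is_arg_min_def closed_loop_total_cost
  using closed_loop_stabilizing total_cost_lower_bound by (auto simp: not_less)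

end

section \<open>The Lyapunov property and the conclusion\<close>

lemma global_lyapunov_value: "global_lyapunov (\<lambda>z. f z - f xs) F xs"
proof -
  have "GDERIV (\<lambda>z. f z - f xs) z :> grad f z" for z
    using GDERIV_diff[OF GDERIV_grad[OF diff] GDERIV_const] by simp
  then have grad_V: "grad (\<lambda>z. f z - f xs) = grad f"
    using grad_eqI by blast
  have "F xs = 0" by (simp add: F_eq grad_xs argmax_zero)
  moreover have "C1_function (\<lambda>z. f z - f xs)"
    unfolding C1_function_def grad_V using diff cont_grad by (simp add: differentiable_diff)
  \<comment> \<open>Level-boundedness confines the points with \<open>f z - f xs \<le> Z\<close> to
    a ball, so the value exceeds \<open>Z\<close> outside a slightly larger one.\<close>
  moreover have "filterlim (\<lambda>z. f z - f xs) at_top at_infinity"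
    unfolding filterlim_at_top_dense
  proof
    fix Z
    obtain B where B: "\<And>z. f z \<le> Z + f xs \<Longrightarrow> norm z \<le> B"
      using level unfolding level_bounded_def bounded_iff by (metis mem_Collect_eq)
    show "eventually (\<lambda>z. Z < f z - f xs) at_infinity"
      unfolding eventually_at_infinity
    proof (intro exI allI impI)
      fix z :: 'a assume "B + 1 \<le> norm z"
      then show "Z < f z - f xs" using B[of z] by (cases "f z \<le> Z + f xs") auto
    qed
  qed
  ultimately show ?thesis
    unfolding global_lyapunov_def grad_V
    using xs_less F_strict_descent by (simp add: inner_commute)
qed

end

text \<open>Existence of a closed-loop solution is a separate conjunct, so that optimality of the
  feedback along every solution is not vacuous.\<close>

theorem mainTheorem4:
  fixes f :: "real ^ 'n \<Rightarrow> real"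
    and \<phi> :: "real ^ 'n \<Rightarrow> ereal"
    and \<mu> :: real
    and xs :: "real ^ 'n"
  assumes "C2_function f"
    and "level_bounded f"
    and "strictly_convex f"
    and "supercoercive f"
    and "xs = (THE x. is_arg_min f (\<lambda>_. True) x)"
    and "proper \<phi>"
    and "lower_semicont \<phi>"
    and "essentially_smooth \<phi>"
    and "\<mu> > 0"
    and "strongly_convex \<mu> \<phi>"
    and "\<forall>x. \<phi> x \<ge> 0"
    and "\<forall>x. \<phi> (- x) = \<phi> x"
    and "\<phi> 0 = 0"
  shows
    "(\<forall>x0.
        (\<forall>u. stabilizing_control f x0 u \<longrightarrow>
           (\<forall>t\<ge>0. cost_on {0..t} f \<phi> x0 u
                    \<ge> ereal (bregman f x0 xs - bregman f (trajectory x0 u t) xs)) \<and>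
           J_infinity f \<phi> x0 u \<ge> ereal (bregman f x0 xs)) \<and>
        (\<exists>x. solves_ode (closed_loop_field f \<phi>) x0 x) \<and>
        (\<forall>x. solves_ode (closed_loop_field f \<phi>) x0 x \<longrightarrow>
           (let u = (\<lambda>t. closed_loop_field f \<phi> (x t)) in
             optimal_stabilizing_control f \<phi> x0 u \<and>
             J_infinity f \<phi> x0 u = ereal (bregman f x0 xs)))) \<and>
     global_lyapunov (\<lambda>x. bregman f x xs) (closed_loop_field f \<phi>) xs"
proof -
  interpret optimal_control \<phi> \<mu> f xs
    using assms by unfold_locales auto
  show ?thesis
    unfolding bregman_xs Let_def
  proof (intro conjI allI impI)
    fix x0 u assume u: "stabilizing_control f x0 u"
    show "ereal (f x0 - f xs) \<le> J_infinity f \<phi> x0 u"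
      by (rule total_cost_lower_bound[OF u])
    show "ereal (f x0 - f xs - (f (trajectory x0 u t) - f xs)) \<le> cost_on {0..t} f \<phi> x0 u"
      if "0 \<le> t" for t
      using cost_lower_bound[OF u that] by simp
  next
    fix x0 show "\<exists>x. solves_ode F x0 x" by (rule closed_loop_solution_exists)
  next
    fix x0 x assume "solves_ode F x0 x"
    then show "optimal_stabilizing_control f \<phi> x0 (\<lambda>t. F (x t))"
      and "J_infinity f \<phi> x0 (\<lambda>t. F (x t)) = ereal (f x0 - f xs)"
      by (rule closed_loop_optimal, rule closed_loop_total_cost)
  qed (rule global_lyapunov_value)
qed

end
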